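(* Let $\lambda>0$, $c>0$, $t>0$ and let $k\ge 1$ be an integer. Let $\eta_k(t)$ be the hyperbolic distance from the origin $O$, at time $t$, of the particle returning to the origin at the $k$-th change of direction, as described in the context. Then $$E\{\cosh\eta_k(t)\mid N(t)\ge k\}=\frac{\lambda^k e^{-\lambda t}}{\sqrt{\lambda^2+4c^2}\,\Pr\{N(t)\ge k\}}\left\{\frac{e^{At}}{A^{k-1}}-\frac{e^{Bt}}{B^{k-1}}+\sum_{i=1}^{k-1}\left(\frac{1}{B^i}-\frac{1}{A^i}\right)\frac{t^{k-i-1}}{(k-i-1)!}\right\},$$ where $$A=\tfrac12\left(\lambda+\sqrt{\lambda^2+4c^2}\right),\qquad B=\tfrac12\left(\lambda-\sqrt{\lambda^2+4c^2}\right),$$ and, for $k=1$, the sum is intended to be zero.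
   Context: Basic motion: on the Poincaré upper half-plane $H_2^+=\{(x,y):y>0\}$ with metric $\mathrm ds^2=(\mathrm dx^2+\mathrm dy^2)/y^2$, a particle starts at the origin $O=(0,1)$ and moves with constant hyperbolic speed $c>0$ along geodesics, initially on the half-circumference with center $(0,0)$ and radius $1$. Changes of direction occur at the event times $0<T_1<T_2<\cdots$ of a homogeneous Poisson process $N(t)$ of rate $\lambda>0$: at time $T_n$ the particle is at a point $P_n$ and starts moving along the geodesic through $P_n$ orthogonal to the geodesic joining $O$ and $P_n$, in either of the two directions with probability $1/2$ each. By the hyperbolic Pythagorean theorem, the distance $\eta(t)\ge 0$ from $O$ satisfies, on $\{N(t)=n\}$ and with $T_0=0$, $\cosh\eta(t)=\cosh c(t-T_n)\prod_{j=1}^{n}\cosh c(T_j-T_{j-1})$. Motion with return to the origin at the $k$-th event: at the time $T_k=\inf\{t:N(t)=k\}$ the particle jumps back to $O$ and commences the motion from scratch (for the last time), the subsequent changes of direction being governed by the same Poisson process, i.e. occurring at $T_{k+1},T_{k+2},\dots$. Its hyperbolic distance from $O$ at time $t\ge T_k$ is denoted $\eta_k(t)=\eta(t-T_k)$; on $\{N(t)=n\}$ with $n\ge k$ it is given by $$\cosh\eta_k(t)=\cosh c(t-T_n)\prod_{j=k+1}^{n}\cosh c(T_j-T_{j-1}),$$ the empty product being $1$. *)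

theory Defs
  imports "HOL-Probability.Probability"
begin

text \<open>The upper half-plane is the set of complex numbers with positive imaginary part, with
  origin \<^term>\<open>\<i>\<close>. The following is the distance of the metric
  $(dx^2 + dy^2)/y^2$.\<close>

definition hyp_dist :: "complex \<Rightarrow> complex \<Rightarrow> real" where
  "hyp_dist z w = arcosh (1 + (dist z w)\<^sup>2 / (2 * Im z * Im w))"

text \<open>Unit speed geodesic line which at parameter 0 passes through \<open>p\<close> with Euclidean direction
  \<open>u\<close>, where \<open>norm u = 1\<close>. The lemmas \<open>hyp_dist_geod\<close> and \<open>geod_derivative\<close> below justify this.
  The metric is conformal, so angles between geodesics are Euclidean angles between the
  directions.\<close>

definition geod :: "complex \<Rightarrow> complex \<Rightarrow> real \<Rightarrow> complex" where
  "geod p u s =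
     (let d = cosh s - Im u * sinh s
      in Complex (Re p + Im p * Re u * sinh s / d) (Im p / d))"

lemma geod_denom_pos:
  assumes "norm u = 1"
  shows "cosh s - Im u * sinh s > (0::real)"
proof -
  have "\<bar>Im u\<bar> \<le> 1" using abs_Im_le_cmod[of u] assms by simp
  then have "Im u * sinh s \<le> \<bar>sinh s\<bar>"
    by (metis abs_ge_self abs_mult abs_ge_zero mult_left_le_one_le order_trans)
  also have "\<dots> < cosh s"
    by (metis abs_minus_cancel abs_if cosh_minus sinh_less_cosh_real sinh_minus)
  finally show ?thesis by simp
qed

lemma Im_geod_pos: "norm u = 1 \<Longrightarrow> Im p > 0 \<Longrightarrow> Im (geod p u s) > 0"
  using geod_denom_pos[of u s] by (simp add: geod_def Let_def)

lemma geod_0 [simp]: "geod p u 0 = p"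
  by (simp add: geod_def complex_eq_iff)

lemma geod_derivative:
  assumes "norm u = 1" "Im p > 0"
  shows "(geod p u has_vector_derivative of_real (Im p) * u) (at 0)"
  unfolding has_vector_derivative_complex_iff geod_def Let_def complex.sel
  using assms by (auto intro!: derivative_eq_intros simp: field_simps)

lemma hyp_dist_geod:
  assumes u: "norm u = 1" and p: "Im p > 0"
  shows "hyp_dist (geod p u s) (geod p u r) = \<bar>s - r\<bar>"
proof -
  define a b y where "a = Re u" and "b = Im u" and "y = Im p"
  define d where "d = (\<lambda>s. cosh s - b * sinh s)"
  have d: "d s > 0" "d r > 0" using geod_denom_pos[OF u] by (auto simp: d_def b_def)
  have ab: "a\<^sup>2 = 1 - b\<^sup>2" using u by (simp add: a_def b_def cmod_def)
  have g: "geod p u x = Complex (Re p + y * a * sinh x / d x) (y / d x)" for x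
    by (simp add: geod_def Let_def a_def b_def y_def d_def)
  have y: "y > 0" using p by (simp add: y_def)
  have dd: "dist (geod p u s) (geod p u r) ^ 2
      = y\<^sup>2 * (a\<^sup>2 * (sinh s * d r - sinh r * d s)\<^sup>2 + (d r - d s)\<^sup>2) / (d s * d r)\<^sup>2"
  proof -
    have "Re (geod p u s) - Re (geod p u r) = y * a * (sinh s * d r - sinh r * d s) / (d s * d r)"
      "Im (geod p u s) - Im (geod p u r) = y * (d r - d s) / (d s * d r)"
      using d by (simp_all add: g field_simps)
    then show ?thesis
      by (simp add: dist_norm cmod_power2 power_mult_distrib power_divide
          add_divide_distrib[symmetric] distrib_left mult.assoc)
  qed
  have c2: "(cosh x)\<^sup>2 = (sinh x)\<^sup>2 + 1" for x :: real by (rule cosh_square_eq)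
  have key: "a\<^sup>2 * (sinh s * d r - sinh r * d s)\<^sup>2 + (d r - d s)\<^sup>2
      = 2 * (cosh (s - r) - 1) * (d s * d r)"
  proof -
    have "a\<^sup>2 * (S * (C' - b * S') - S' * (C - b * S))\<^sup>2 + ((C' - b * S') - (C - b * S))\<^sup>2
      = 2 * (C * C' - S * S' - 1) * ((C - b * S) * (C' - b * S'))"
      if "C\<^sup>2 = S\<^sup>2 + 1" "C'\<^sup>2 = S'\<^sup>2 + 1" for C S C' S' :: real
      using that ab by algebra
    from this[OF c2 c2] show ?thesis by (simp add: d_def cosh_diff)
  qed
  have "1 + dist (geod p u s) (geod p u r) ^ 2 / (2 * (y / d s) * (y / d r)) = cosh (s - r)"
    unfolding dd key using d y by (simp add: field_simps power2_eq_square)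
  then have "hyp_dist (geod p u s) (geod p u r) = arcosh (cosh (s - r))"
    by (simp add: hyp_dist_def g)
  also have "\<dots> = \<bar>s - r\<bar>"
    by (metis arcosh_cosh_real abs_ge_zero cosh_real_abs)
  finally show ?thesis .
qed

text \<open>Direction at \<open>p\<close> (which must not be the origin) of the geodesic coming from the origin.\<close>

definition radial :: "complex \<Rightarrow> complex" where
  "radial p = (THE v. norm v = 1 \<and> geod p v (- hyp_dist \<i> p) = \<i>)"

lemma radial_ex1:
  assumes p: "Im p > 0" "p \<noteq> \<i>"
  shows "\<exists>!v. norm v = 1 \<and> geod p v (- hyp_dist \<i> p) = \<i>"
proof -
  define h where "h = hyp_dist \<i> p"
  have D: "(dist \<i> p)\<^sup>2 = (Re p)\<^sup>2 + (Im p - 1)\<^sup>2"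
    by (simp add: dist_norm cmod_def power2_commute)
  have pos: "(dist \<i> p)\<^sup>2 / (2 * Im p) > 0" using p by simp
  have ch: "cosh h = 1 + (dist \<i> p)\<^sup>2 / (2 * Im p)"
    using pos by (simp add: h_def hyp_dist_def cosh_arcosh_real)
  then have eq: "2 * Im p * cosh h = (Re p)\<^sup>2 + (Im p)\<^sup>2 + 1"
    using p D by (simp add: field_simps power2_eq_square)
  have h: "sinh h \<noteq> 0"
    using ch pos cosh_square_eq[of h] by auto
  have iff: "geod p v (- h) = \<i> \<longleftrightarrow> v = Complex (Re p / sinh h) ((Im p - cosh h) / sinh h)"
    if v: "norm v = 1" for v
  proof -
    define D where "D = cosh h + Im v * sinh h"
    have D: "D > 0" using geod_denom_pos[OF v, of "-h"] by (simp add: D_def)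
    have "geod p v (- h) = \<i> \<longleftrightarrow> Re p - Im p * Re v * sinh h / D = 0 \<and> Im p / D = 1"
      by (simp add: geod_def Let_def complex_eq_iff D_def)
    also have "\<dots> \<longleftrightarrow> Re v * sinh h = Re p \<and> Im p = D" using D by auto
    also have "\<dots> \<longleftrightarrow> v = Complex (Re p / sinh h) ((Im p - cosh h) / sinh h)"
      using h by (auto simp: complex_eq_iff D_def field_simps)
    finally show ?thesis .
  qed
  have "(Re p)\<^sup>2 + (Im p - cosh h)\<^sup>2 = (sinh h)\<^sup>2"
    using eq cosh_square_eq[of h] by (simp add: power2_diff algebra_simps)
  then have "norm (Complex (Re p / sinh h) ((Im p - cosh h) / sinh h)) = 1"
    using h by (simp add: cmod_def power_divide add_divide_distrib[symmetric])
  then show ?thesis unfolding h_def[symmetric] using iff by blast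
qed

text \<open>A trajectory is driven by times \<open>S 0 = 0 < S 1 < S 2 < \<dots>\<close> and coins \<open>b 0, b 1, \<dots>\<close>:
  \<open>b 0\<close> is the orientation on the initial half-circumference, \<open>b n\<close> the orientation chosen at
  the \<open>n\<close>-th change of direction, and \<open>vertex c S b n\<close> the position at time \<open>S n\<close>.\<close>

definition heading :: "(nat \<Rightarrow> bool) \<Rightarrow> nat \<Rightarrow> complex \<Rightarrow> complex" where
  "heading b n p = (if b n then 1 else - 1) * (if n = 0 then 1 else \<i> * radial p)"

primrec vertex :: "real \<Rightarrow> (nat \<Rightarrow> real) \<Rightarrow> (nat \<Rightarrow> bool) \<Rightarrow> nat \<Rightarrow> complex" where
  "vertex c S b 0 = \<i>"
| "vertex c S b (Suc n) =
     geod (vertex c S b n) (heading b n (vertex c S b n)) (c * (S (Suc n) - S n))"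

definition num_events :: "(nat \<Rightarrow> real) \<Rightarrow> real \<Rightarrow> nat" where
  "num_events S t = card {n. 1 \<le> n \<and> S n \<le> t}"

definition particle :: "real \<Rightarrow> (nat \<Rightarrow> real) \<Rightarrow> (nat \<Rightarrow> bool) \<Rightarrow> real \<Rightarrow> complex" where
  "particle c S b t =
     (let n = num_events S t
      in geod (vertex c S b n) (heading b n (vertex c S b n)) (c * (t - S n)))"

definition returning_particle ::
    "nat \<Rightarrow> real \<Rightarrow> (nat \<Rightarrow> real) \<Rightarrow> (nat \<Rightarrow> bool) \<Rightarrow> real \<Rightarrow> complex" where
  "returning_particle k c S b t =
     (if t < S k then particle c S b t
      else particle c (\<lambda>j. S (k + j) - S k) (\<lambda>j. b (k + j)) (t - S k))"

text \<open>\<open>T 1 < T 2 < \<dots>\<close> are the event times of a homogeneous Poisson process of rate \<open>l\<close>, that is,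
  their counting process \<open>\<lambda>t. num_events (\<lambda>n. T n \<omega>) t\<close> has independent Poisson increments;
  \<open>T 0 = 0\<close> is a convention. The differences of counts are subtractions on \<^typ>\<open>nat\<close>, which do
  not truncate, since the count is nondecreasing in time.\<close>

definition (in prob_space) poisson_event_times :: "real \<Rightarrow> (nat \<Rightarrow> 'a \<Rightarrow> real) \<Rightarrow> bool" where
  "poisson_event_times l T \<longleftrightarrow>
     (\<forall>n. random_variable borel (T n)) \<and>
     (\<forall>\<omega>\<in>space M. T 0 \<omega> = 0 \<and> strict_mono (\<lambda>n. T n \<omega>) \<and> (\<forall>t. finite {n. T n \<omega> \<le> t})) \<and>
     (\<forall>\<tau> :: nat \<Rightarrow> real. \<forall>m. 0 \<le> \<tau> 0 \<and> mono \<tau> \<longrightarrow>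
        indep_vars (\<lambda>_. count_space UNIV)
          (\<lambda>i \<omega>. num_events (\<lambda>n. T n \<omega>) (\<tau> (Suc i)) - num_events (\<lambda>n. T n \<omega>) (\<tau> i))
          {..<m}) \<and>
     (\<forall>s t. 0 \<le> s \<and> s < t \<longrightarrow>
        distr M (count_space UNIV)
          (\<lambda>\<omega>. num_events (\<lambda>n. T n \<omega>) t - num_events (\<lambda>n. T n \<omega>) s)
        = measure_pmf (poisson_pmf (l * (t - s))))"

text \<open>Fair coins, independent of each other and of the event times.\<close>

definition (in prob_space) fair_coins ::
    "(nat \<Rightarrow> 'a \<Rightarrow> real) \<Rightarrow> (nat \<Rightarrow> 'a \<Rightarrow> bool) \<Rightarrow> bool" where
  "fair_coins T b \<longleftrightarrow>
     indep_vars (\<lambda>_. count_space UNIV) b UNIV \<and>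
     (\<forall>n. distr M (count_space UNIV) (b n) = measure_pmf (bernoulli_pmf (1/2))) \<and>
     indep_set
       (sets (vimage_algebra (space M) (\<lambda>\<omega> n. T n \<omega>) (\<Pi>\<^sub>M n\<in>UNIV. borel)))
       (sets (vimage_algebra (space M) (\<lambda>\<omega> n. b n \<omega>) (\<Pi>\<^sub>M n\<in>UNIV. count_space UNIV)))"

end

theory Submission
  imports Defs "HOL-Real_Asymp.Real_Asymp"
begin

text \<open>By the hyperbolic Pythagorean theorem the hyperbolic cosine of the distance is a product over
  the legs of the path; the coins do not matter. Let \<open>u\<close> be its mean on the event that the return
  has taken place, and \<open>v\<close> the mean of the same product with \<open>sinh\<close> in the last factor. During
  a short time \<open>h\<close> the pair is rotated hyperbolically when there is no event, and an event, which
  is independent of the past, annihilates the second component. With an error of order \<open>h\<^sup>2\<close> this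
  gives \<open>u' = c v + l p\<close> and \<open>v' = c u - l v\<close>, where \<open>p\<close> is the probability of exactly \<open>k - 1\<close>
  events. As \<open>A + B = l\<close> and \<open>A B = - c\<^sup>2\<close>, the solution vanishing at \<open>0\<close> is a combination of the
  Taylor remainders of \<open>exp (A t)\<close> and \<open>exp (B t)\<close>.\<close>

section \<open>Hyperbolic distance along a trajectory\<close>

text \<open>The process is given through its counts at fixed times; neither the joint law of the
  event times nor a Markov property at the random time of the return is given directly. Short
  deterministic intervals avoid both: the only probabilistic inputs are the Poisson law and the
  independence of one increment from the history. The mean of the hyperbolic cosine alone satisfies
  no closed first-order equation, since the addition theorem brings in the hyperbolic sine of the
  current leg; hence the companion \<open>v\<close>. Setting both quantities to 0 before the return
  gives zero initial values and turns the return into the source term \<open>l p\<close>; the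
  conditional mean is \<open>u\<close> divided by the probability of the conditioning event. Step
  estimates going forward in time control right-hand difference quotients only. What upgrades them
  to derivatives is that their constants are uniform on a compact time interval. The solution is
  identified by an energy estimate.\<close>

lemma cosh_hyp_dist_origin:
  assumes "Im q > 0"
  shows "cosh (hyp_dist \<i> q) = ((Re q)\<^sup>2 + (Im q)\<^sup>2 + 1) / (2 * Im q)"
proof -
  have D: "(dist \<i> q)\<^sup>2 = (Re q)\<^sup>2 + (Im q - 1)\<^sup>2"
    by (simp add: dist_norm cmod_def power2_commute)
  have "1 + (dist \<i> q)\<^sup>2 / (2 * Im q) \<ge> 1" using assms by simp
  then have "cosh (hyp_dist \<i> q) = 1 + (dist \<i> q)\<^sup>2 / (2 * Im q)"
    by (simp add: hyp_dist_def cosh_arcosh_real)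
  then show ?thesis
    using assms unfolding D by (simp add: field_simps power2_eq_square)
qed

lemma radial_spec:
  assumes "Im p > 0" "p \<noteq> \<i>"
  shows "norm (radial p) = 1" "geod p (radial p) (- hyp_dist \<i> p) = \<i>"
  using theI'[OF radial_ex1[OF assms]] unfolding radial_def by auto

text \<open>Multiplication by \<open>\<i>\<close> is a quarter turn, so the triangle formed by the
  origin, \<open>p\<close> and the end point has a right angle at \<open>p\<close>. In coordinates
  the claim is a polynomial consequence of the unit length and orthogonality of the two directions,
  of \<open>cosh_square_eq\<close>, and of the fact that the radial geodesic run backwards reaches
  the origin.\<close>

lemma hyperbolic_pythagoras:
  assumes p: "Im p > 0" "p \<noteq> \<i>" and e: "e = 1 \<or> e = - 1"
  shows "cosh (hyp_dist \<i> (geod p (e * (\<i> * radial p)) s)) = cosh (hyp_dist \<i> p) * cosh s"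
proof -
  define v where "v = radial p"
  define u where "u = e * (\<i> * v)"
  define H where "H = cosh (hyp_dist \<i> p)"
  define K where "K = sinh (hyp_dist \<i> p)"
  have v: "norm v = 1" "geod p v (- hyp_dist \<i> p) = \<i>"
    using radial_spec[OF p] by (auto simp: v_def)
  have u: "norm u = 1" using e v by (auto simp: u_def norm_mult)
  have v2: "(Re v)\<^sup>2 + (Im v)\<^sup>2 = 1" using v(1) by (simp add: cmod_def)
  have u2: "(Re u)\<^sup>2 + (Im u)\<^sup>2 = 1" using u by (simp add: cmod_def)
  have orth: "Re u * Re v + Im u * Im v = 0" using e by (auto simp: u_def)
  have d0: "H + Im v * K > 0"
    using geod_denom_pos[OF v(1), of "- hyp_dist \<i> p"] by (simp add: H_def K_def)
  \<comment> \<open>The equation \<open>v(2)\<close> read in coordinates: it expresses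
    \<open>p\<close> through its distance from the origin and its radial direction.\<close>
  have r: "Re v * K = Re p" "Im p = H + Im v * K"
    using v(2) d0 by (auto simp: geod_def Let_def complex_eq_iff H_def K_def)
  have HK: "H\<^sup>2 = K\<^sup>2 + 1" unfolding H_def K_def by (rule cosh_square_eq)
  define C S where "C = cosh s" and "S = sinh s"
  have CS: "C\<^sup>2 = S\<^sup>2 + 1" unfolding C_def S_def by (rule cosh_square_eq)
  define d where "d = C - Im u * S"
  have d: "d > 0" using geod_denom_pos[OF u, of s] by (simp add: d_def C_def S_def)
  have g: "Re (geod p u s) = Re p + Im p * Re u * S / d" "Im (geod p u s) = Im p / d"
    by (simp_all add: geod_def Let_def d_def C_def S_def)
  have "(Re p * d + Im p * Re u * S)\<^sup>2 + (Im p)\<^sup>2 + d\<^sup>2 = 2 * Im p * d * (H * C)"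
    using v2 u2 orth r HK CS d_def by algebra
  then have "((Re p + Im p * Re u * S / d)\<^sup>2 + (Im p / d)\<^sup>2 + 1) / (2 * (Im p / d)) = H * C"
    using d p by (simp add: field_simps power2_eq_square)
  then have "cosh (hyp_dist \<i> (geod p u s)) = H * C"
    unfolding cosh_hyp_dist_origin[OF Im_geod_pos[OF u p(1)]] g .
  then show ?thesis by (simp add: u_def v_def H_def C_def)
qed

text \<open>The second hypothesis keeps later vertices away from the origin, where no radial
  direction exists. At the start the heading is horizontal, and the multiplication rule persists
  because the distance is 0 and its hyperbolic cosine is 1.\<close>

lemma heading_step:
  assumes p: "Im p > 0" "n = 0 \<longleftrightarrow> p = \<i>"
  shows "Im (geod p (heading b n p) s) > 0"
    and "cosh (hyp_dist \<i> (geod p (heading b n p) s)) = cosh (hyp_dist \<i> p) * cosh s"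
proof -
  define e :: complex where "e = (if b n then 1 else - 1)"
  have e: "e = 1 \<or> e = - 1" by (auto simp: e_def)
  have "norm (heading b n p) = 1"
    using radial_spec(1)[of p] p by (auto simp: heading_def norm_mult)
  then show "Im (geod p (heading b n p) s) > 0" using p(1) by (rule Im_geod_pos)
  show "cosh (hyp_dist \<i> (geod p (heading b n p) s)) = cosh (hyp_dist \<i> p) * cosh s"
  proof (cases "n = 0")
    case True
    then have "p = \<i>" "norm e = 1" "heading b n p = e" using p e by (auto simp: heading_def e_def)
    moreover from this have "hyp_dist \<i> (geod \<i> e s) = \<bar>s\<bar>"
      using hyp_dist_geod[of e \<i> 0 s] by simp
    moreover have "hyp_dist \<i> \<i> = 0" by (simp add: hyp_dist_def)
    ultimately show ?thesis by simp
  next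
    case False
    then have "heading b n p = e * (\<i> * radial p)" by (simp add: heading_def e_def)
    then show ?thesis using hyperbolic_pythagoras[OF p(1) _ e] False p by simp
  qed
qed

section \<open>Products of hyperbolic cosines over the legs\<close>

lemma cosh_gt_1: "x \<noteq> 0 \<Longrightarrow> cosh (x::real) > 1"
  using cosh_real_ge_1[of x] cosh_real_one_iff[of x] by linarith

lemma cosh_le_exp: "x \<ge> 0 \<Longrightarrow> cosh (x::real) \<le> exp x"
  unfolding cosh_def by simp

text \<open>Since sinh x is at most cosh x, lengthening a leg by y costs at most the factor cosh y +
  sinh y = exp y.\<close>

lemma cosh_add_le: "0 \<le> x \<Longrightarrow> 0 \<le> y \<Longrightarrow> cosh (x + y) \<le> cosh (x::real) * exp y"
proof -
  assume "0 \<le> x" "0 \<le> y"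
  have "cosh (x + y) = cosh x * cosh y + sinh x * sinh y" by (rule cosh_add)
  also have "\<dots> \<le> cosh x * cosh y + cosh x * sinh y"
    using \<open>0 \<le> y\<close> by (intro add_left_mono mult_right_mono) (auto simp: less_imp_le sinh_less_cosh_real)
  also have "\<dots> = cosh x * exp y" by (simp add: cosh_plus_sinh[symmetric] algebra_simps)
  finally show ?thesis .
qed

definition leg_prod :: "real \<Rightarrow> (nat \<Rightarrow> real) \<Rightarrow> nat \<Rightarrow> nat \<Rightarrow> real" where
  "leg_prod c S i n = (\<Prod>j = i..<n. cosh (c * (S (Suc j) - S j)))"

lemma leg_prod_self [simp]: "leg_prod c S i i = 1"
  by (simp add: leg_prod_def)

lemma leg_prod_Suc:
  "i \<le> n \<Longrightarrow> leg_prod c S i (Suc n) = leg_prod c S i n * cosh (c * (S (Suc n) - S n))"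
  by (simp add: leg_prod_def)

lemma leg_prod_split: "i \<le> j \<Longrightarrow> j \<le> n \<Longrightarrow> leg_prod c S i n = leg_prod c S i j * leg_prod c S j n"
  by (simp add: leg_prod_def prod.atLeastLessThan_concat)

lemma leg_prod_ge_1: "leg_prod c S i n \<ge> 1"
  unfolding leg_prod_def by (intro prod_ge_1) (auto simp: cosh_real_ge_1)

lemma leg_prod_shift: "leg_prod c (\<lambda>j. S (k + j) - a) 0 n = leg_prod c S k (k + n)"
  unfolding leg_prod_def using prod.shift_bounds_nat_ivl[of "\<lambda>j. cosh (c * (S (Suc j) - S j))" 0 k n]
  by (simp add: add.commute)

text \<open>From cosh x \<le> exp x and telescoping of the leg lengths. The bound does not depend on
  the number of legs, which is what makes the random product bounded at a fixed time.\<close>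

lemma leg_prod_le_exp:
  assumes "c \<ge> 0" "mono S" "i \<le> n"
  shows "leg_prod c S i n \<le> exp (c * (S n - S i))"
  using assms(3)
proof (induction n rule: dec_induct)
  case (step n)
  have "leg_prod c S i (Suc n) \<le> exp (c * (S n - S i)) * exp (c * (S (Suc n) - S n))"
    unfolding leg_prod_Suc[OF step(1)]
    using assms(1) monoD[OF assms(2), of n "Suc n"] step
    by (intro mult_mono cosh_le_exp) auto
  then show ?case by (simp add: exp_add[symmetric] algebra_simps)
qed simp

text \<open>All path properties are proved for a fixed sequence of event times; the random sequence
  satisfies the locale pointwise. Local finiteness keeps the count meaningful, as
  \<open>card\<close> of an infinite set is 0.\<close>

locale event_path =
  fixes S :: "nat \<Rightarrow> real"
  assumes S_0 [simp]: "S 0 = 0"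
    and strict_mono: "strict_mono S"
    and locally_finite: "finite {n. S n \<le> r}"
begin

lemma mono: "mono S"
  by (rule strict_mono_mono[OF strict_mono])

lemma nonneg: "S n \<ge> 0"
  using monoD[OF mono, of 0 n] by simp

text \<open>The counted indices form an initial segment of the positive integers, by monotonicity.
  This equivalence is the bridge between counts and event times on which the later facts about
  counts rest; the case \<open>n = 0\<close> relies on \<open>S 0 = 0\<close>.\<close>

lemma num_events_ge_iff:
  assumes "r \<ge> 0"
  shows "n \<le> num_events S r \<longleftrightarrow> S n \<le> r"
proof -
  let ?D = "{n. 1 \<le> n \<and> S n \<le> r}"
  have fin: "finite ?D" by (rule finite_subset[OF _ locally_finite[of r]]) auto
  have down: "m \<in> ?D" if "1 \<le> m" "m \<le> n" "S n \<le> r" for m n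
    using that monoD[OF mono, of m n] by auto
  show ?thesis
  proof
    assume "S n \<le> r"
    then have "{1..n} \<subseteq> ?D" using down by auto
    from card_mono[OF fin this] show "n \<le> num_events S r" by (simp add: num_events_def)
  next
    assume n: "n \<le> num_events S r"
    show "S n \<le> r"
    proof (rule ccontr)
      assume no: "\<not> S n \<le> r"
      have "?D \<subseteq> {1..<n}"
      proof
        fix m assume "m \<in> ?D"
        then show "m \<in> {1..<n}" using no monoD[OF mono, of n m] by (cases "n \<le> m") auto
      qed
      from card_mono[OF _ this] have "num_events S r \<le> n - 1" by (simp add: num_events_def)
      with n have "n = 0" by simp
      with no assms show False by simp
    qed
  qed
qed

lemma event_le: "r \<ge> 0 \<Longrightarrow> S (num_events S r) \<le> r"
  using num_events_ge_iff by blast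

lemma less_event: "r \<ge> 0 \<Longrightarrow> num_events S r < n \<Longrightarrow> r < S n"
  using num_events_ge_iff[of r n] by auto

lemma num_events_0 [simp]: "num_events S 0 = 0"
  using num_events_ge_iff[of 0 1] strict_monoD[OF strict_mono, of 0 1]
  by (cases "num_events S 0") auto

lemma num_events_mono: "0 \<le> r \<Longrightarrow> r \<le> q \<Longrightarrow> num_events S r \<le> num_events S q"
  using num_events_ge_iff[of q "num_events S r"] event_le[of r] by simp

lemma num_events_unique:
  assumes "r \<ge> 0" "S n \<le> r" "r < S (Suc n)"
  shows "num_events S r = n"
  using assms num_events_ge_iff[of r n] num_events_ge_iff[of r "Suc n"] by simp

lemma shift: "event_path (\<lambda>j. S (k + j) - S k)"
proof
  show "strict_mono (\<lambda>j. S (k + j) - S k)"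
    using strict_mono by (auto simp: strict_mono_def)
  fix r
  have "{n. S (k + n) - S k \<le> r} = (\<lambda>n. k + n) -` {n. S n \<le> r + S k}" by auto
  moreover have "finite \<dots>" by (intro finite_vimageI locally_finite) (auto simp: inj_def)
  ultimately show "finite {n. S (k + n) - S k \<le> r}" by simp
qed simp

lemma num_events_shift:
  assumes "S k \<le> r"
  shows "num_events S r = k + num_events (\<lambda>j. S (k + j) - S k) (r - S k)"
proof (rule num_events_unique)
  interpret sh: event_path "\<lambda>j. S (k + j) - S k" by (rule shift)
  show "r \<ge> 0" using assms nonneg[of k] by simp
  show "S (k + num_events (\<lambda>j. S (k + j) - S k) (r - S k)) \<le> r"
    using sh.event_le[of "r - S k"] assms by simp
  show "r < S (Suc (k + num_events (\<lambda>j. S (k + j) - S k) (r - S k)))"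
    using sh.less_event[of "r - S k" "Suc (num_events (\<lambda>j. S (k + j) - S k) (r - S k))"] assms
    by simp
qed

context
  fixes c :: real
  assumes c: "c > 0"
begin

text \<open>The three claims need a joint induction: the product rule for the next leg requires the
  vertex to differ from the origin, and this holds because the product over legs of positive length
  exceeds 1.\<close>

lemma vertex_props:
  "Im (vertex c S b n) > 0 \<and> cosh (hyp_dist \<i> (vertex c S b n)) = leg_prod c S 0 n
   \<and> (n = 0 \<longleftrightarrow> vertex c S b n = \<i>)"
proof (induction n)
  case 0
  show ?case by (simp add: hyp_dist_def)
next
  case (Suc n)
  let ?s = "c * (S (Suc n) - S n)"
  note step = heading_step[of "vertex c S b n" n b ?s]
  have ch: "cosh (hyp_dist \<i> (vertex c S b (Suc n))) = leg_prod c S 0 (Suc n)"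
    using Suc step(2) by (simp add: leg_prod_Suc)
  have "?s > 0" using c strict_monoD[OF strict_mono, of n "Suc n"] by simp
  then have "1 * 1 < leg_prod c S 0 n * cosh ?s"
    by (intro mult_le_less_imp_less) (auto simp: leg_prod_ge_1 intro!: cosh_gt_1)
  then have "cosh (hyp_dist \<i> (vertex c S b (Suc n))) > 1"
    unfolding ch by (simp add: leg_prod_Suc)
  moreover have "cosh (hyp_dist \<i> \<i>) = 1" by (simp add: hyp_dist_def)
  ultimately have "vertex c S b (Suc n) \<noteq> \<i>" by force
  then show ?case using ch step(1) Suc by simp
qed

lemma cosh_hyp_dist_particle:
  fixes r defines "n \<equiv> num_events S r"
  shows "cosh (hyp_dist \<i> (particle c S b r)) = leg_prod c S 0 n * cosh (c * (r - S n))"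
  using heading_step(2)[of "vertex c S b n" n b "c * (r - S n)"] vertex_props[of b n]
  by (simp add: particle_def n_def Let_def)

end

end

text \<open>The hyperbolic cosine of the distance of the returning particle and the companion in which
  the last leg enters through \<open>sinh\<close>, both killed before the return. Between events the pair
  evolves by a hyperbolic rotation; an event resets the second component to 0.\<close>

definition return_cosh :: "real \<Rightarrow> nat \<Rightarrow> (nat \<Rightarrow> real) \<Rightarrow> real \<Rightarrow> real" where
  "return_cosh c k S r =
     (let n = num_events S r in if k \<le> n then leg_prod c S k n * cosh (c * (r - S n)) else 0)"

definition return_sinh :: "real \<Rightarrow> nat \<Rightarrow> (nat \<Rightarrow> real) \<Rightarrow> real \<Rightarrow> real" where
  "return_sinh c k S r =
     (let n = num_events S r in if k \<le> n then leg_prod c S k n * sinh (c * (r - S n)) else 0)"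

context event_path
begin

context
  fixes c :: real and k :: nat
  assumes c: "c > 0"
begin

lemma cosh_hyp_dist_returning_particle:
  assumes "S k \<le> r"
  shows "cosh (hyp_dist \<i> (returning_particle k c S b r)) = return_cosh c k S r"
proof -
  interpret sh: event_path "\<lambda>j. S (k + j) - S k" by (rule shift)
  show ?thesis
    using assms sh.cosh_hyp_dist_particle[OF c, of "\<lambda>j. b (k + j)" "r - S k"]
    by (simp add: returning_particle_def return_cosh_def num_events_shift Let_def leg_prod_shift)
qed

text \<open>Before the return the motion is the basic one, which is the case \<open>k = 0\<close> of
  the functional. It serves to show that the distance is measurable on the whole space, not only on
  the conditioning event.\<close>

lemma cosh_hyp_dist_returning_particle_before:
  assumes "r < S k"
  shows "cosh (hyp_dist \<i> (returning_particle k c S b r)) = return_cosh c 0 S r"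
  using assms cosh_hyp_dist_particle[OF c, of b r]
  by (simp add: returning_particle_def return_cosh_def Let_def)

lemma return_sinh_nonneg: "0 \<le> r \<Longrightarrow> 0 \<le> return_sinh c k S r"
  using event_le[of r] c leg_prod_ge_1[of c S k "num_events S r"]
  by (simp add: return_sinh_def Let_def)

lemma return_sinh_le_cosh: "return_sinh c k S r \<le> return_cosh c k S r"
  using leg_prod_ge_1[of c S k "num_events S r"] sinh_less_cosh_real[of "c * (r - S (num_events S r))"]
  by (simp add: return_sinh_def return_cosh_def Let_def)

lemma return_cosh_le_exp:
  assumes "0 \<le> r"
  shows "return_cosh c k S r \<le> exp (c * r)"
proof (cases "k \<le> num_events S r")
  case True
  define n where "n = num_events S r"
  have "leg_prod c S k n * cosh (c * (r - S n)) \<le> exp (c * (S n - S k)) * exp (c * (r - S n))"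
    using c True event_le[OF assms]
    by (intro mult_mono leg_prod_le_exp mono cosh_le_exp) (auto simp: n_def)
  also have "\<dots> \<le> exp (c * r)"
    using c nonneg[of k] by (simp add: exp_add[symmetric] algebra_simps)
  finally show ?thesis using True by (simp add: return_cosh_def Let_def n_def)
qed (simp add: return_cosh_def)

lemma return_cosh_step:
  assumes rh: "0 \<le> r" "0 \<le> h" and same: "num_events S (r + h) = num_events S r"
  shows "return_cosh c k S (r + h)
    = return_cosh c k S r * cosh (c * h) + return_sinh c k S r * sinh (c * h)"
proof -
  define n where "n = num_events S r"
  have "c * (r + h - S n) = c * (r - S n) + c * h" by (simp add: algebra_simps)
  then show ?thesis
    unfolding return_cosh_def return_sinh_def same Let_def n_def[symmetric]
    by (simp add: cosh_add distrib_left mult_ac)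
qed

lemma return_sinh_step:
  assumes rh: "0 \<le> r" "0 \<le> h" and same: "num_events S (r + h) = num_events S r"
  shows "return_sinh c k S (r + h)
    = return_sinh c k S r * cosh (c * h) + return_cosh c k S r * sinh (c * h)"
proof -
  define n where "n = num_events S r"
  have "c * (r + h - S n) = c * (r - S n) + c * h" by (simp add: algebra_simps)
  then show ?thesis
    unfolding return_cosh_def return_sinh_def same Let_def n_def[symmetric]
    by (simp add: sinh_add distrib_left mult_ac)
qed

text \<open>The current leg began after time \<open>r\<close>, so its hyperbolic length is at most
  \<open>c * h\<close>, and the completed legs are bounded by an exponential. The value is thus of
  order \<open>h\<close> on an event whose probability is itself of order \<open>h\<close>.\<close>

lemma return_sinh_event:
  assumes rh: "0 \<le> r" "0 \<le> h" and event: "num_events S r < num_events S (r + h)"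
  shows "return_sinh c k S (r + h) \<le> sinh (c * h) * exp (c * (r + h))"
proof (cases "k \<le> num_events S (r + h)")
  case True
  define n where "n = num_events S (r + h)"
  have "leg_prod c S k n \<le> exp (c * (S n - S k))"
    using c True by (intro leg_prod_le_exp mono) (auto simp: n_def)
  also have "\<dots> \<le> exp (c * (r + h))"
    using c nonneg[of k] event_le[of "r + h"] rh by (simp add: n_def)
  finally have L: "leg_prod c S k n \<le> exp (c * (r + h))" .
  have "c * (r + h - S n) \<le> c * h"
    using c less_event[OF rh(1) event] by (simp add: n_def)
  then have "leg_prod c S k n * sinh (c * (r + h - S n)) \<le> exp (c * (r + h)) * sinh (c * h)"
    using L c event_le[of "r + h"] rh by (intro mult_mono) (auto simp: n_def)
  then show ?thesis using True by (simp add: return_sinh_def Let_def n_def mult.commute)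
qed (use c rh in \<open>simp add: return_sinh_def\<close>)

text \<open>If the return has already happened, a change of direction alters the value by a factor
  between 1 and \<open>exp (c * h)\<close>. If the next event is the return, the value is created
  near 1, which the \<open>of_bool\<close> on the left subtracts. The last term on the right pays
  for a return that is not the first event of the interval; this takes at least two events.\<close>

lemma return_cosh_event:
  assumes rh: "0 \<le> r" "0 \<le> h" and event: "num_events S r < num_events S (r + h)"
  shows "\<bar>return_cosh c k S (r + h) - return_cosh c k S r - of_bool (Suc (num_events S r) = k)\<bar>
    \<le> (exp (c * h) - 1) * exp (c * r) + of_bool (num_events S r + 2 \<le> num_events S (r + h)) * exp (c * (r + h))"
proof -
  define n where "n = num_events S r"
  define n' where "n' = num_events S (r + h)"
  have n: "n < n'" using event by (simp add: n_def n'_def)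
  have r: "S n \<le> r" "r < S (Suc n)" "S n' \<le> r + h" "S (Suc n) \<le> S n'"
    using rh event_le[of r] less_event[of r "Suc n"] event_le[of "r + h"] n monoD[OF mono, of "Suc n" n']
    by (auto simp: n_def n'_def)
  have ch: "exp (c * h) \<ge> 1" using c rh by simp
  consider "k \<le> n" | "k = Suc n" | "n + 2 \<le> k" "k \<le> n'" | "n + 2 \<le> k" "n' < k"
    by linarith
  then show ?thesis
  proof cases
    case 1
    define Z where "Z = leg_prod c S k n * cosh (c * (r - S n))"
    have Z: "return_cosh c k S r = Z" using 1 by (simp add: return_cosh_def Let_def n_def Z_def)
    define Z' where "Z' = leg_prod c S k n' * cosh (c * (r + h - S n'))"
    have Z': "return_cosh c k S (r + h) = Z'"
      using 1 n by (simp add: return_cosh_def Let_def n'_def Z'_def)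
    have split: "Z' = leg_prod c S k n * cosh (c * (S (Suc n) - S n)) *
        (leg_prod c S (Suc n) n' * cosh (c * (r + h - S n')))"
      using leg_prod_split[of k "Suc n" n' c S] leg_prod_Suc[of k n c S] 1 n by (simp add: Z'_def)
    have "Z * 1 \<le> Z'"
      unfolding split
    proof (rule mult_mono)
      show "Z \<le> leg_prod c S k n * cosh (c * (S (Suc n) - S n))"
        unfolding Z_def using c r leg_prod_ge_1[of c S k n]
        by (intro mult_left_mono) (auto simp: cosh_real_nonneg_le_iff)
      have "1 * 1 \<le> leg_prod c S (Suc n) n' * cosh (c * (r + h - S n'))"
        by (intro mult_mono leg_prod_ge_1 cosh_real_ge_1) (use leg_prod_ge_1[of c S "Suc n" n'] in auto)
      then show "1 \<le> leg_prod c S (Suc n) n' * cosh (c * (r + h - S n'))" by simp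
    qed (use leg_prod_ge_1[of c S k n] in auto)
    moreover have "Z' \<le> (Z * exp (c * (S (Suc n) - r))) * (exp (c * (S n' - S (Suc n))) * exp (c * (r + h - S n')))"
      unfolding split
    proof (rule mult_mono)
      \<comment> \<open>The leg in progress at time \<open>r\<close> is cut there: the part before
        \<open>r\<close> is contained in \<open>Z\<close>, the rest costs an exponential factor.
        Together with the later legs these factors multiply to \<open>exp (c * h)\<close>.\<close>
      have "cosh (c * (r - S n) + c * (S (Suc n) - r)) \<le> cosh (c * (r - S n)) * exp (c * (S (Suc n) - r))"
        using c r by (intro cosh_add_le) auto
      then show "leg_prod c S k n * cosh (c * (S (Suc n) - S n)) \<le> Z * exp (c * (S (Suc n) - r))"
        using leg_prod_ge_1[of c S k n] by (simp add: Z_def algebra_simps)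
      show "leg_prod c S (Suc n) n' * cosh (c * (r + h - S n'))
          \<le> exp (c * (S n' - S (Suc n))) * exp (c * (r + h - S n'))"
        using c r n by (intro mult_mono leg_prod_le_exp mono cosh_le_exp) auto
    qed (use leg_prod_ge_1[of c S k n] leg_prod_ge_1[of c S "Suc n" n'] in \<open>auto simp: Z_def\<close>)
    then have "Z' \<le> Z * exp (c * h)"
      by (simp add: exp_add[symmetric] mult.assoc algebra_simps)
    moreover have "Z * (exp (c * h) - 1) \<le> exp (c * r) * (exp (c * h) - 1)"
      using return_cosh_le_exp[OF rh(1)] ch by (intro mult_right_mono) (auto simp: Z)
    ultimately have "\<bar>Z' - Z\<bar> \<le> (exp (c * h) - 1) * exp (c * r)"
      by (simp add: algebra_simps abs_le_iff)
    then show ?thesis using 1 by (auto simp: Z Z' n_def[symmetric] intro: add_increasing2)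
  next
    case 2
    define Z' where "Z' = leg_prod c S k n' * cosh (c * (r + h - S n'))"
    have Z': "return_cosh c k S (r + h) = Z'"
      using 2 n by (simp add: return_cosh_def Let_def n'_def Z'_def)
    have "1 * 1 \<le> Z'" unfolding Z'_def
      by (intro mult_mono leg_prod_ge_1 cosh_real_ge_1) (use leg_prod_ge_1[of c S k n'] in auto)
    moreover have "Z' \<le> exp (c * (S n' - S k)) * exp (c * (r + h - S n'))"
      unfolding Z'_def using c r n 2 by (intro mult_mono leg_prod_le_exp mono cosh_le_exp) auto
    then have "Z' \<le> exp (c * (r + h - S k))" by (simp add: exp_add[symmetric] algebra_simps)
    then have "Z' \<le> exp (c * h)" by (rule order_trans) (use r c 2 in simp)
    moreover have "(exp (c * h) - 1) * 1 \<le> (exp (c * h) - 1) * exp (c * r)"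
      using ch c rh by (intro mult_left_mono) auto
    ultimately have "\<bar>Z' - 1\<bar> \<le> (exp (c * h) - 1) * exp (c * r)" by simp
    moreover have "return_cosh c k S r = 0" using 2 by (simp add: return_cosh_def Let_def n_def)
    ultimately show ?thesis
      using 2 Z' by (auto simp: n_def[symmetric] intro: add_increasing2)
  next
    case 3
    have "return_cosh c k S r = 0" using 3 by (simp add: return_cosh_def Let_def n_def)
    moreover have "0 \<le> return_cosh c k S (r + h)"
      using return_sinh_nonneg[of "r + h"] return_sinh_le_cosh[of "r + h"] rh by simp
    moreover have "0 \<le> (exp (c * h) - 1) * exp (c * r)" using ch by simp
    ultimately show ?thesis
      using 3 return_cosh_le_exp[of "r + h"] rh by (simp add: n_def[symmetric] n'_def[symmetric])
  next
    case 4
    then have "return_cosh c k S r = 0" "return_cosh c k S (r + h) = 0"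
      using n by (simp_all add: return_cosh_def Let_def n_def n'_def)
    then show ?thesis using 4 ch by (simp add: n_def[symmetric])
  qed
qed

end

end

section \<open>Independence of the increments from the past\<close>

lemma measurable_count_space_natI:
  assumes "\<And>n. {\<omega> \<in> space M. n \<le> f \<omega>} \<in> sets M"
  shows "f \<in> M \<rightarrow>\<^sub>M count_space (UNIV :: nat set)"
proof -
  have "f -` {n} \<inter> space M = {\<omega> \<in> space M. n \<le> f \<omega>} - {\<omega> \<in> space M. Suc n \<le> f \<omega>}" for n
    by auto
  then show ?thesis
    using assms by (auto simp: measurable_count_space_eq2_countable)
qed

lemma (in prob_space) expectation_of_bool:
  "expectation (\<lambda>\<omega>. of_bool (P \<omega>) :: real) = prob {\<omega> \<in> space M. P \<omega>}"
proof -
  have "expectation (\<lambda>\<omega>. of_bool (P \<omega>) :: real) = expectation (indicator {\<omega> \<in> space M. P \<omega>})"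
    by (intro Bochner_Integration.integral_cong) (auto simp: indicator_def)
  moreover have "{\<omega> \<in> space M. P \<omega>} \<inter> space M = {\<omega> \<in> space M. P \<omega>}" by auto
  ultimately show ?thesis by simp
qed

section \<open>The counting process of the random event times\<close>

locale poisson_events = prob_space M for M :: "'a measure" +
  fixes l :: real and T :: "nat \<Rightarrow> 'a \<Rightarrow> real"
  assumes events: "poisson_event_times l T" and rate_pos: "l > 0"
begin

definition N :: "real \<Rightarrow> 'a \<Rightarrow> nat" where
  "N s \<omega> = num_events (\<lambda>n. T n \<omega>) s"

lemma path: "\<omega> \<in> space M \<Longrightarrow> event_path (\<lambda>n. T n \<omega>)"
  using events by unfold_locales (auto simp: poisson_event_times_def)

lemma T_measurable [measurable]: "T n \<in> borel_measurable M"
  using events by (auto simp: poisson_event_times_def)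

lemma le_N_iff: "\<omega> \<in> space M \<Longrightarrow> 0 \<le> s \<Longrightarrow> n \<le> N s \<omega> \<longleftrightarrow> T n \<omega> \<le> s"
  unfolding N_def by (rule event_path.num_events_ge_iff[OF path])

lemma N_mono: "\<omega> \<in> space M \<Longrightarrow> 0 \<le> s \<Longrightarrow> s \<le> r \<Longrightarrow> N s \<omega> \<le> N r \<omega>"
  unfolding N_def by (rule event_path.num_events_mono[OF path])

lemma N_0: "\<omega> \<in> space M \<Longrightarrow> N 0 \<omega> = 0"
  unfolding N_def by (rule event_path.num_events_0[OF path])

lemma N_measurable [measurable]:
  assumes "0 \<le> s"
  shows "N s \<in> M \<rightarrow>\<^sub>M count_space UNIV"
proof (rule measurable_count_space_natI)
  fix n
  have "{\<omega> \<in> space M. n \<le> N s \<omega>} = {\<omega> \<in> space M. T n \<omega> \<le> s}"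
    using le_N_iff assms by auto
  then show "{\<omega> \<in> space M. n \<le> N s \<omega>} \<in> sets M" by simp
qed

lemma increment_distr:
  assumes "0 \<le> s" "0 < h"
  shows "prob {\<omega> \<in> space M. P (N (s + h) \<omega> - N s \<omega>)} = measure (poisson_pmf (l * h)) {n. P n}"
proof -
  have [measurable]: "N s \<in> M \<rightarrow>\<^sub>M count_space UNIV" "N (s + h) \<in> M \<rightarrow>\<^sub>M count_space UNIV"
    using assms by auto
  have "distr M (count_space UNIV) (\<lambda>\<omega>. N (s + h) \<omega> - N s \<omega>) = measure_pmf (poisson_pmf (l * h))"
    using events assms by (simp add: poisson_event_times_def N_def)
  then have "measure (poisson_pmf (l * h)) {n. P n}
      = measure (distr M (count_space UNIV) (\<lambda>\<omega>. N (s + h) \<omega> - N s \<omega>)) {n. P n}"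
    by simp
  also have "\<dots> = prob ((\<lambda>\<omega>. N (s + h) \<omega> - N s \<omega>) -` {n. P n} \<inter> space M)"
    by (rule measure_distr) simp_all
  also have "(\<lambda>\<omega>. N (s + h) \<omega> - N s \<omega>) -` {n. P n} \<inter> space M = {\<omega> \<in> space M. P (N (s + h) \<omega> - N s \<omega>)}"
    by auto
  finally show ?thesis ..
qed

lemma prob_no_event:
  assumes "0 \<le> s" "0 \<le> h"
  shows "prob {\<omega> \<in> space M. N (s + h) \<omega> = N s \<omega>} = exp (- l * h)"
proof (cases "h = 0")
  case False
  have "{\<omega> \<in> space M. N (s + h) \<omega> = N s \<omega>} = {\<omega> \<in> space M. N (s + h) \<omega> - N s \<omega> = 0}"
    using N_mono[of _ s "s + h"] assms by force
  moreover have "prob \<dots> = measure (poisson_pmf (l * h)) {n. n = 0}"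
    using False assms by (intro increment_distr) auto
  ultimately show ?thesis
    using rate_pos assms False by (simp add: measure_pmf_single)
qed (simp add: prob_space)

lemma prob_two_events:
  assumes "0 \<le> s" "0 \<le> h"
  shows "prob {\<omega> \<in> space M. N s \<omega> + 2 \<le> N (s + h) \<omega>} \<le> (l * h)\<^sup>2"
proof (cases "h = 0")
  case False
  have "{\<omega> \<in> space M. N s \<omega> + 2 \<le> N (s + h) \<omega>} = {\<omega> \<in> space M. N (s + h) \<omega> - N s \<omega> \<ge> 2}"
    using N_mono[of _ s "s + h"] assms by force
  moreover have "prob \<dots> = measure (poisson_pmf (l * h)) {n. n \<ge> 2}"
    using False assms by (intro increment_distr) auto
  also have "{n :: nat. n \<ge> 2} = space (poisson_pmf (l * h)) - {0, 1}" by auto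
  also have "measure (poisson_pmf (l * h)) \<dots> = 1 - measure (poisson_pmf (l * h)) {0, 1}"
    by (rule measure_pmf.prob_compl) simp
  also have "measure (poisson_pmf (l * h)) {0, 1} = exp (- (l * h)) * (1 + l * h)"
    using rate_pos assms False by (subst measure_measure_pmf_finite) (auto simp: algebra_simps)
  also have "1 - \<dots> \<le> (l * h)\<^sup>2"
  proof -
    \<comment> \<open>With x = l h, the bound exp (-x) \<ge> 1 - x leaves at most 1 - (1 - x) (1 +
      x), the square of x.\<close>
    have "(1 - l * h) * (1 + l * h) \<le> exp (- (l * h)) * (1 + l * h)"
      using rate_pos assms exp_ge_add_one_self[of "- (l * h)"] by (intro mult_right_mono) auto
    then show ?thesis by (simp add: algebra_simps power2_eq_square)
  qed
  finally show ?thesis .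
qed simp

lemma prob_N:
  assumes "0 \<le> s"
  shows "prob {\<omega> \<in> space M. N s \<omega> = n} = exp (- l * s) * (l * s) ^ n / fact n"
proof (cases "s = 0")
  case True
  have "{\<omega> \<in> space M. N 0 \<omega> = n} = (if n = 0 then space M else {})" using N_0 by auto
  then show ?thesis using True by (simp add: prob_space power_0_left)
next
  case False
  have "{\<omega> \<in> space M. N s \<omega> = n} = {\<omega> \<in> space M. N (0 + s) \<omega> - N 0 \<omega> = n}"
    using N_0 by auto
  also have "prob \<dots> = measure (poisson_pmf (l * s)) {m. m = n}"
    using False assms by (intro increment_distr) auto
  finally show ?thesis
    using rate_pos assms False by (simp add: measure_pmf_single)
qed

text \<open>The natural filtration of the counting process. Lower bounds on counts serve as
  generators because by \<open>le_N_iff\<close> they are also statements about event times.\<close>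

definition history :: "real \<Rightarrow> 'a measure" where
  "history s = sigma (space M) {{\<omega> \<in> space M. n \<le> N q \<omega>} | n q. 0 \<le> q \<and> q \<le> s}"

lemma space_history [simp]: "space (history s) = space M"
  by (simp add: history_def space_measure_of_conv)

lemma sets_history:
  "sets (history s) = sigma_sets (space M) {{\<omega> \<in> space M. n \<le> N q \<omega>} | n q. 0 \<le> q \<and> q \<le> s}"
  unfolding history_def by (rule sets_measure_of) auto

lemma history_le_N: "0 \<le> q \<Longrightarrow> q \<le> s \<Longrightarrow> {\<omega> \<in> space M. n \<le> N q \<omega>} \<in> sets (history s)"
  unfolding sets_history by (rule sigma_sets.Basic) blast

lemma sets_history_le: "sets (history s) \<subseteq> sets M"
  unfolding sets_history by (intro sets.sigma_sets_subset) auto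

lemma measurable_history: "f \<in> history s \<rightarrow>\<^sub>M X \<Longrightarrow> f \<in> M \<rightarrow>\<^sub>M X"
  using sets_history_le[of s] by (auto simp: measurable_def)

text \<open>The sets prescribing lower bounds for the count at finitely many times form an
  intersection-stable generator of the history. Such a set depends on the increments between these
  times only.\<close>

lemma finite_history_indep:
  assumes s: "0 \<le> s" "0 \<le> h" and J: "finite J" "J \<subseteq> {0..s}"
  shows "prob ({\<omega> \<in> space M. \<forall>q\<in>J. a q \<le> N q \<omega>} \<inter> {\<omega> \<in> space M. N (s + h) \<omega> - N s \<omega> \<in> D})
    = prob {\<omega> \<in> space M. \<forall>q\<in>J. a q \<le> N q \<omega>} * prob {\<omega> \<in> space M. N (s + h) \<omega> - N s \<omega> \<in> D}"
proof -
  \<comment> \<open>The time grid consists of 0, the elements of \<open>J\<close> in order,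
    \<open>s\<close>, and finally \<open>s + h\<close>. Repeated grid points are harmless, as
    \<open>\<tau>\<close> only has to be monotone. Index \<open>m\<close> is the time
    \<open>s\<close>, so the increment numbered \<open>m\<close> is the one over the interval from
    \<open>s\<close> to \<open>s + h\<close>.\<close>
  define xs where "xs = 0 # sorted_list_of_set J @ [s]"
  define m where "m = Suc (card J)"
  define \<tau> where "\<tau> i = (if i \<le> m then xs ! i else s + h)" for i
  have len: "length xs = Suc m" using J by (simp add: xs_def m_def)
  have xs_set: "set xs = {0, s} \<union> J" using J by (auto simp: xs_def)
  have srt: "sorted xs" using J s by (auto simp: xs_def sorted_append)
  have ele: "0 \<le> xs ! i" "xs ! i \<le> s" if "i \<le> m" for i
  proof -
    have "xs ! i \<in> set xs" using that len by (intro nth_mem) simp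
    then show "0 \<le> xs ! i" "xs ! i \<le> s" using xs_set J s by auto
  qed
  have \<tau>0: "\<tau> 0 = 0" by (simp add: \<tau>_def xs_def)
  have \<tau>m: "\<tau> m = s" "\<tau> (Suc m) = s + h"
    using J by (simp_all add: \<tau>_def xs_def m_def nth_append)
  have mono_\<tau>: "mono \<tau>"
  proof (rule monoI)
    fix i j :: nat assume "i \<le> j"
    then show "\<tau> i \<le> \<tau> j"
      using sorted_nth_mono[OF srt, of i j] len ele(2)[of i] s by (auto simp: \<tau>_def)
  qed
  have \<tau>_nonneg: "0 \<le> \<tau> i" for i using monoD[OF mono_\<tau>, of 0 i] \<tau>0 by simp
  define X where "X i \<omega> = N (\<tau> (Suc i)) \<omega> - N (\<tau> i) \<omega>" for i \<omega>
  have ind: "indep_vars (\<lambda>_. count_space UNIV) X {..<Suc m}"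
    using events mono_\<tau> \<tau>0 by (simp add: poisson_event_times_def X_def[abs_def] N_def)
  have N_sum: "N (\<tau> i) \<omega> = (\<Sum>j<i. X j \<omega>)" if "\<omega> \<in> space M" for i \<omega>
  proof (induction i)
    case (Suc i)
    have "N (\<tau> i) \<omega> \<le> N (\<tau> (Suc i)) \<omega>"
      using that \<tau>_nonneg monoD[OF mono_\<tau>, of i "Suc i"] by (intro N_mono) auto
    with Suc show ?case by (simp add: X_def)
  qed (use that in \<open>simp add: \<tau>0 N_0\<close>)
  have "\<exists>i\<le>m. \<tau> i = q" if "q \<in> J" for q
  proof -
    have "q \<in> set xs" using that xs_set by auto
    then show ?thesis using len by (auto simp: in_set_conv_nth \<tau>_def less_Suc_eq_le)
  qed
  then obtain idx where idx: "\<And>q. q \<in> J \<Longrightarrow> idx q \<le> m \<and> \<tau> (idx q) = q" by metis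
  \<comment> \<open>Counts at the times in \<open>J\<close> are partial sums of the first
    \<open>m\<close> increments, so the past is described by \<open>E\<close> in terms of these
    alone and the new increment by \<open>E'\<close>.\<close>
  define E where "E = {f \<in> {..<m} \<rightarrow>\<^sub>E UNIV. \<forall>q\<in>J. a q \<le> (\<Sum>j<idx q. f j :: nat)}"
  define E' where "E' = {f \<in> {m} \<rightarrow>\<^sub>E UNIV. f m \<in> D}"
  have "prob ((\<lambda>\<omega>. (\<lambda>i\<in>{..<m}. X i \<omega>, \<lambda>i\<in>{m}. X i \<omega>)) -` (E \<times> E') \<inter> space M)
    = prob ((\<lambda>\<omega>. \<lambda>i\<in>{..<m}. X i \<omega>) -` E \<inter> space M) * prob ((\<lambda>\<omega>. \<lambda>i\<in>{m}. X i \<omega>) -` E' \<inter> space M)"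
  proof (rule indep_varD)
    show "indep_var (PiM {..<m} (\<lambda>_. count_space UNIV)) (\<lambda>\<omega>. \<lambda>i\<in>{..<m}. X i \<omega>)
        (PiM {m} (\<lambda>_. count_space UNIV)) (\<lambda>\<omega>. \<lambda>i\<in>{m}. X i \<omega>)"
      by (rule indep_var_restrict[OF ind]) auto
  qed (auto simp: count_space_PiM_finite E_def E'_def)
  moreover have "(\<Sum>j<idx q. (\<lambda>i\<in>{..<m}. X i \<omega>) j) = N q \<omega>" if "q \<in> J" "\<omega> \<in> space M" for q \<omega>
  proof -
    have "(\<Sum>j<idx q. (\<lambda>i\<in>{..<m}. X i \<omega>) j) = (\<Sum>j<idx q. X j \<omega>)"
      using idx[OF that(1)] by (intro sum.cong) auto
    also have "\<dots> = N q \<omega>" using N_sum[OF that(2), of "idx q"] idx[OF that(1)] by simp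
    finally show ?thesis .
  qed
  then have "(\<lambda>\<omega>. \<lambda>i\<in>{..<m}. X i \<omega>) -` E \<inter> space M = {\<omega> \<in> space M. \<forall>q\<in>J. a q \<le> N q \<omega>}"
    by (auto simp: E_def)
  moreover have "(\<lambda>\<omega>. \<lambda>i\<in>{m}. X i \<omega>) -` E' \<inter> space M = {\<omega> \<in> space M. N (s + h) \<omega> - N s \<omega> \<in> D}"
    by (auto simp: E'_def X_def \<tau>m)
  moreover have "(\<lambda>\<omega>. (\<lambda>i\<in>{..<m}. X i \<omega>, \<lambda>i\<in>{m}. X i \<omega>)) -` (E \<times> E') \<inter> space M
      = ((\<lambda>\<omega>. \<lambda>i\<in>{..<m}. X i \<omega>) -` E \<inter> space M) \<inter> ((\<lambda>\<omega>. \<lambda>i\<in>{m}. X i \<omega>) -` E' \<inter> space M)"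
    by auto
  ultimately show ?thesis by simp
qed

text \<open>Independence passes from intersection-stable families to the sigma-algebras they
  generate; \<open>finite_history_indep\<close> supplies it for the finite constraints
  \<open>G\<close>, which contain the generators of the history.\<close>

lemma history_indep_increment:
  assumes s: "0 \<le> s" "0 \<le> h"
  shows "indep_set (sets (history s)) (sigma_sets (space M)
    {(\<lambda>\<omega>. N (s + h) \<omega> - N s \<omega>) -` D \<inter> space M | D. D \<in> sets (count_space UNIV)})"
proof -
  define G where "G = {{\<omega> \<in> space M. \<forall>q\<in>J. a q \<le> N q \<omega>} | J a. finite J \<and> J \<subseteq> {0..s}}"
  define Y where "Y = {(\<lambda>\<omega>. N (s + h) \<omega> - N s \<omega>) -` D \<inter> space M | D. D \<in> sets (count_space UNIV)}"
  have [measurable]: "N s \<in> M \<rightarrow>\<^sub>M count_space UNIV" "N (s + h) \<in> M \<rightarrow>\<^sub>M count_space UNIV"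
    using s by auto
  have Y_events: "Y \<subseteq> events"
  proof -
    have "(\<lambda>\<omega>. N (s + h) \<omega> - N s \<omega>) \<in> M \<rightarrow>\<^sub>M count_space UNIV" by measurable
    then show ?thesis unfolding Y_def by (auto intro: measurable_sets)
  qed
  have G_events: "G \<subseteq> events"
  proof -
    have "{\<omega> \<in> space M. \<forall>q\<in>J. a q \<le> N q \<omega>} \<in> events" if "finite J" "J \<subseteq> {0..s}" for J a
      using that by (intro sets.sets_Collect_finite_All) auto
    then show ?thesis by (auto simp: G_def)
  qed
  have "indep_set (sigma_sets (space M) G) (sigma_sets (space M) Y)"
  proof (rule indep_set_sigma_sets)
    show "indep_set G Y"
    proof (rule indep_setI[OF G_events Y_events])
      fix A B assume "A \<in> G" "B \<in> Y"
      then obtain J a D where AB: "finite J" "J \<subseteq> {0..s}" "A = {\<omega> \<in> space M. \<forall>q\<in>J. a q \<le> N q \<omega>}"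
        "B = {\<omega> \<in> space M. N (s + h) \<omega> - N s \<omega> \<in> D}"
        by (auto simp: G_def Y_def)
      show "prob (A \<inter> B) = prob A * prob B"
        unfolding AB using s AB by (intro finite_history_indep)
    qed
    show "Int_stable G"
    proof (rule Int_stableI)
      fix A B assume "A \<in> G" "B \<in> G"
      then obtain J a J' a' where AB: "finite J" "J \<subseteq> {0..s}" "A = {\<omega> \<in> space M. \<forall>q\<in>J. a q \<le> N q \<omega>}"
        "finite J'" "J' \<subseteq> {0..s}" "B = {\<omega> \<in> space M. \<forall>q\<in>J'. a' q \<le> N q \<omega>}"
        by (auto simp: G_def)
      \<comment> \<open>A time that occurs in only one of the two index sets gets the default bound
        0 from the other, which every count satisfies.\<close>
      let ?a = "\<lambda>q. max (if q \<in> J then a q else 0) (if q \<in> J' then a' q else 0)"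
      have "A \<inter> B = {\<omega> \<in> space M. \<forall>q\<in>J \<union> J'. ?a q \<le> N q \<omega>}" unfolding AB by auto
      moreover have "\<dots> \<in> G"
        unfolding G_def using AB by (intro CollectI exI[of _ "J \<union> J'"] exI[of _ ?a]) auto
      ultimately show "A \<inter> B \<in> G" by simp
    qed
    show "Int_stable Y"
    proof (rule Int_stableI)
      fix A B assume "A \<in> Y" "B \<in> Y"
      then obtain D D' where "A = (\<lambda>\<omega>. N (s + h) \<omega> - N s \<omega>) -` D \<inter> space M"
        "B = (\<lambda>\<omega>. N (s + h) \<omega> - N s \<omega>) -` D' \<inter> space M"
        by (auto simp: Y_def)
      then have "A \<inter> B = (\<lambda>\<omega>. N (s + h) \<omega> - N s \<omega>) -` (D \<inter> D') \<inter> space M" by auto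
      then show "A \<inter> B \<in> Y"
        unfolding Y_def by (intro CollectI exI[of _ "D \<inter> D'"]) simp
    qed
  qed
  moreover have "sets (history s) \<subseteq> sigma_sets (space M) G"
    unfolding sets_history
  proof (rule sigma_sets_mono)
    show "{{\<omega> \<in> space M. n \<le> N q \<omega>} | n q. 0 \<le> q \<and> q \<le> s} \<subseteq> sigma_sets (space M) G"
    proof clarify
      fix n q assume q: "0 \<le> q" "q \<le> s"
      have "{\<omega> \<in> space M. n \<le> N q \<omega>} = {\<omega> \<in> space M. \<forall>r\<in>{q}. (\<lambda>_. n) r \<le> N r \<omega>}" by simp
      moreover have "\<dots> \<in> G" unfolding G_def
        by (intro CollectI exI[of _ "{q}"] exI[of _ "\<lambda>_. n"]) (use q in auto)
      ultimately show "{\<omega> \<in> space M. n \<le> N q \<omega>} \<in> sigma_sets (space M) G" by auto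
    qed
  qed
  ultimately show ?thesis
    unfolding indep_set_def Y_def[symmetric]
    by (elim indep_sets_mono_sets) (auto split: bool.splits)
qed

text \<open>The absence of events between \<open>s\<close> and \<open>s + h\<close> is a condition
  on the increment, hence independent of every \<open>Z\<close> determined by the history.
  Complements cover the case that some event occurs, so the evolution estimates need independence in
  this form only.\<close>

lemma expectation_no_event:
  assumes s: "0 \<le> s" "0 \<le> h"
    and Z: "Z \<in> borel_measurable (history s)" "integrable M Z"
  shows "integrable M (\<lambda>\<omega>. of_bool (N (s + h) \<omega> = N s \<omega>) * Z \<omega>)" (is ?int)
    and "expectation (\<lambda>\<omega>. of_bool (N (s + h) \<omega> = N s \<omega>) * Z \<omega>) = exp (- l * h) * expectation Z" (is ?eq)
proof -
  define Y where "Y = (\<lambda>\<omega>. N (s + h) \<omega> - N s \<omega>)"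
  define X :: "'a \<Rightarrow> real" where "X \<omega> = of_bool (Y \<omega> = 0)" for \<omega>
  have [measurable]: "N s \<in> M \<rightarrow>\<^sub>M count_space UNIV" "N (s + h) \<in> M \<rightarrow>\<^sub>M count_space UNIV"
    using s by auto
  have [measurable]: "Y \<in> M \<rightarrow>\<^sub>M count_space UNIV" unfolding Y_def by measurable
  have X [measurable]: "X \<in> borel_measurable M" unfolding X_def by measurable
  \<comment> \<open>Truncated subtraction vanishes exactly when the counts agree, because counts do
    not decrease.\<close>
  have X_eq: "X \<omega> = of_bool (N (s + h) \<omega> = N s \<omega>)" if "\<omega> \<in> space M" for \<omega>
    using N_mono[OF that, of s "s + h"] s by (simp add: X_def Y_def)
  have ZX: "indep_var borel Z borel X"
  proof -
    have "{Z -` A \<inter> space M | A. A \<in> sets borel} \<subseteq> sets (history s)"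
      using measurable_sets[OF Z(1)] by auto
    from sets.sigma_sets_subset[OF this]
    have "sigma_sets (space M) {Z -` A \<inter> space M | A. A \<in> sets borel} \<subseteq> sets (history s)"
      by simp
    moreover have "{X -` A \<inter> space M | A. A \<in> sets borel}
        \<subseteq> {Y -` D \<inter> space M | D. D \<in> sets (count_space UNIV)}"
    proof clarify
      fix A :: "real set"
      have "X -` A \<inter> space M = Y -` {n. of_bool (n = 0) \<in> A} \<inter> space M" by (auto simp: X_def)
      then show "\<exists>D. X -` A \<inter> space M = Y -` D \<inter> space M \<and> D \<in> sets (count_space UNIV)"
        by (intro exI conjI) (assumption, simp)
    qed
    then have "sigma_sets (space M) {X -` A \<inter> space M | A. A \<in> sets borel}
        \<subseteq> sigma_sets (space M) {Y -` D \<inter> space M | D. D \<in> sets (count_space UNIV)}"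
      by (rule sigma_sets_mono')
    ultimately have "indep_set (sigma_sets (space M) {Z -` A \<inter> space M | A. A \<in> sets borel})
       (sigma_sets (space M) {X -` A \<inter> space M | A. A \<in> sets borel})"
      using history_indep_increment[OF s] unfolding indep_set_def Y_def[symmetric]
      by (elim indep_sets_mono_sets) (auto split: bool.splits)
    then show ?thesis
      using measurable_history[OF Z(1)] X unfolding indep_var_eq by simp
  qed
  have int: "integrable M X"
    by (rule integrable_const_bound[of _ 1]) (auto simp: X_def)
  have "integrable M (\<lambda>\<omega>. Z \<omega> * X \<omega>)" by (rule indep_var_integrable[OF ZX Z(2) int])
  also have "?this \<longleftrightarrow> ?int"
    by (rule Bochner_Integration.integrable_cong) (auto simp: X_eq)
  finally show ?int .
  have "expectation X = expectation (\<lambda>\<omega>. of_bool (N (s + h) \<omega> = N s \<omega>))"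
    by (intro Bochner_Integration.integral_cong) (auto simp: X_eq)
  also have "\<dots> = exp (- l * h)" using prob_no_event[OF s] by (simp add: expectation_of_bool)
  finally have EX: "expectation X = exp (- l * h)" .
  have "expectation (\<lambda>\<omega>. of_bool (N (s + h) \<omega> = N s \<omega>) * Z \<omega>) = expectation (\<lambda>\<omega>. Z \<omega> * X \<omega>)"
    by (intro Bochner_Integration.integral_cong) (auto simp: X_eq)
  also have "\<dots> = exp (- l * h) * expectation Z"
    using indep_var_lebesgue_integral[OF ZX Z(2) int] EX by simp
  finally show ?eq .
qed

end

section \<open>Evolution of the means over a short time\<close>

lemma abs_integral_le:
  fixes f g :: "'a \<Rightarrow> real"
  assumes "integrable M f" "integrable M g" "\<And>x. x \<in> space M \<Longrightarrow> \<bar>f x\<bar> \<le> g x"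
  shows "\<bar>integral\<^sup>L M f\<bar> \<le> integral\<^sup>L M g"
proof -
  have "\<bar>integral\<^sup>L M f\<bar> \<le> integral\<^sup>L M (\<lambda>x. \<bar>f x\<bar>)" by (rule integral_abs_bound)
  also have "\<dots> \<le> integral\<^sup>L M g" using assms by (intro integral_mono) auto
  finally show ?thesis .
qed

lemma borel_measurable_cosh [measurable (raw)]:
  fixes f :: "'a \<Rightarrow> real"
  assumes "f \<in> borel_measurable M"
  shows "(\<lambda>x. cosh (f x)) \<in> borel_measurable M"
  using assms by (rule borel_measurable_continuous_on[rotated]) (intro continuous_intros)

lemma borel_measurable_sinh [measurable (raw)]:
  fixes f :: "'a \<Rightarrow> real"
  assumes "f \<in> borel_measurable M"
  shows "(\<lambda>x. sinh (f x)) \<in> borel_measurable M"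
  using assms by (rule borel_measurable_continuous_on[rotated]) (intro continuous_intros)

section \<open>Measurability, integrability and short-time evolution of the killed
  functionals\<close>

context poisson_events
begin

lemma N_history [measurable]: "0 \<le> s \<Longrightarrow> N s \<in> history s \<rightarrow>\<^sub>M count_space UNIV"
  by (rule measurable_count_space_natI) (use history_le_N in simp)

text \<open>An event time itself may lie in the future of \<open>s\<close>; stopped at
  \<open>s\<close> it is known from the history. By \<open>stopped_event_eq\<close> stopping changes
  none of the event times that the functionals read at time \<open>s\<close>.\<close>

lemma stopped_event_history [measurable]:
  assumes "0 \<le> s"
  shows "(\<lambda>\<omega>. min (T n \<omega>) s) \<in> borel_measurable (history s)"
proof (rule borel_measurable_iff_le[THEN iffD2], intro allI)
  fix a
  consider "a < 0" | "0 \<le> a" "a < s" | "s \<le> a" by linarith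
  then show "{\<omega> \<in> space (history s). min (T n \<omega>) s \<le> a} \<in> sets (history s)"
  proof cases
    case 1
    have "\<not> min (T n \<omega>) s \<le> a" if "\<omega> \<in> space M" for \<omega>
      using event_path.nonneg[OF path[OF that], of n] assms 1 by auto
    then have "{\<omega> \<in> space (history s). min (T n \<omega>) s \<le> a} = {}" by auto
    then show ?thesis by (simp only: sets.empty_sets)
  next
    case 2
    have "min (T n \<omega>) s \<le> a \<longleftrightarrow> n \<le> N a \<omega>" if "\<omega> \<in> space M" for \<omega>
      using le_N_iff[OF that 2(1), of n] 2(2) by auto
    then have "{\<omega> \<in> space (history s). min (T n \<omega>) s \<le> a} = {\<omega> \<in> space M. n \<le> N a \<omega>}" by auto
    then show ?thesis using history_le_N[of a s n] 2 by simp
  next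
    case 3
    then have "{\<omega> \<in> space (history s). min (T n \<omega>) s \<le> a} = space (history s)" by auto
    then show ?thesis by (simp only: sets.top)
  qed
qed

lemma stopped_event_eq:
  assumes "\<omega> \<in> space M" "0 \<le> s" "n \<le> N s \<omega>"
  shows "min (T n \<omega>) s = T n \<omega>"
  using le_N_iff[OF assms(1,2), of n] assms(3) by simp

text \<open>This and \<open>mean_sinh\<close> are the functions \<open>u\<close> and
  \<open>v\<close> of the overview. The integrand vanishes before the return, so no indicator of the
  conditioning event appears.\<close>

definition mean_cosh :: "real \<Rightarrow> nat \<Rightarrow> real \<Rightarrow> real" where
  "mean_cosh c k s = expectation (\<lambda>\<omega>. return_cosh c k (\<lambda>n. T n \<omega>) s)"

definition mean_sinh :: "real \<Rightarrow> nat \<Rightarrow> real \<Rightarrow> real" where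
  "mean_sinh c k s = expectation (\<lambda>\<omega>. return_sinh c k (\<lambda>n. T n \<omega>) s)"

context
  fixes c :: real
  assumes c: "c > 0"
begin

lemma
  assumes s: "0 \<le> s"
  shows return_cosh_history: "(\<lambda>\<omega>. return_cosh c k (\<lambda>n. T n \<omega>) s) \<in> borel_measurable (history s)"
    and return_sinh_history: "(\<lambda>\<omega>. return_sinh c k (\<lambda>n. T n \<omega>) s) \<in> borel_measurable (history s)"
proof -
  have [measurable]: "(\<lambda>\<omega>. min (T n \<omega>) s) \<in> borel_measurable (history s)" for n
    using s by (rule stopped_event_history)
  define L where "L n \<omega> = leg_prod c (\<lambda>j. min (T j \<omega>) s) k n" for n \<omega>
  have [measurable]: "L n \<in> borel_measurable (history s)" for n
    unfolding L_def leg_prod_def by measurable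
  have L: "L (N s \<omega>) \<omega> = leg_prod c (\<lambda>n. T n \<omega>) k (N s \<omega>)" if "\<omega> \<in> space M" for \<omega>
    unfolding L_def leg_prod_def using stopped_event_eq[OF that s] by (intro prod.cong) auto
  have [measurable]: "N s \<in> history s \<rightarrow>\<^sub>M count_space UNIV" using s by (rule N_history)
  have "(\<lambda>\<omega>. (\<lambda>n \<omega>. if k \<le> n then L n \<omega> * cosh (c * (s - min (T n \<omega>) s)) else 0) (N s \<omega>) \<omega>)
      \<in> borel_measurable (history s)"
    by (rule measurable_compose_countable) measurable
  also have "?this \<longleftrightarrow> (\<lambda>\<omega>. return_cosh c k (\<lambda>n. T n \<omega>) s) \<in> borel_measurable (history s)"
    using L stopped_event_eq[OF _ s]
    by (intro measurable_cong) (simp add: return_cosh_def Let_def N_def)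
  finally show "(\<lambda>\<omega>. return_cosh c k (\<lambda>n. T n \<omega>) s) \<in> borel_measurable (history s)" .
  have "(\<lambda>\<omega>. (\<lambda>n \<omega>. if k \<le> n then L n \<omega> * sinh (c * (s - min (T n \<omega>) s)) else 0) (N s \<omega>) \<omega>)
      \<in> borel_measurable (history s)"
    by (rule measurable_compose_countable) measurable
  also have "?this \<longleftrightarrow> (\<lambda>\<omega>. return_sinh c k (\<lambda>n. T n \<omega>) s) \<in> borel_measurable (history s)"
    using L stopped_event_eq[OF _ s]
    by (intro measurable_cong) (simp add: return_sinh_def Let_def N_def)
  finally show "(\<lambda>\<omega>. return_sinh c k (\<lambda>n. T n \<omega>) s) \<in> borel_measurable (history s)" .
qed

lemma return_bounds:
  assumes "\<omega> \<in> space M" "0 \<le> s"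
  shows "0 \<le> return_sinh c k (\<lambda>n. T n \<omega>) s"
    and "return_sinh c k (\<lambda>n. T n \<omega>) s \<le> return_cosh c k (\<lambda>n. T n \<omega>) s"
    and "return_cosh c k (\<lambda>n. T n \<omega>) s \<le> exp (c * s)"
  using event_path.return_sinh_nonneg[OF path[OF assms(1)] c assms(2)]
    event_path.return_sinh_le_cosh[OF path[OF assms(1)] c]
    event_path.return_cosh_le_exp[OF path[OF assms(1)] c assms(2)]
  by auto

lemma
  assumes s: "0 \<le> s"
  shows return_cosh_integrable: "integrable M (\<lambda>\<omega>. return_cosh c k (\<lambda>n. T n \<omega>) s)"
    and return_sinh_integrable: "integrable M (\<lambda>\<omega>. return_sinh c k (\<lambda>n. T n \<omega>) s)"
proof -
  show "integrable M (\<lambda>\<omega>. return_cosh c k (\<lambda>n. T n \<omega>) s)"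
  proof (rule integrable_const_bound[OF AE_I2])
    fix \<omega> assume "\<omega> \<in> space M"
    from return_bounds[OF this s, of k]
    show "norm (return_cosh c k (\<lambda>n. T n \<omega>) s) \<le> exp (c * s)" by simp
  qed (rule measurable_history[OF return_cosh_history[OF s]])
  show "integrable M (\<lambda>\<omega>. return_sinh c k (\<lambda>n. T n \<omega>) s)"
  proof (rule integrable_const_bound[OF AE_I2])
    fix \<omega> assume "\<omega> \<in> space M"
    from return_bounds[OF this s, of k]
    show "norm (return_sinh c k (\<lambda>n. T n \<omega>) s) \<le> exp (c * s)" by simp
  qed (rule measurable_history[OF return_sinh_history[OF s]])
qed

lemma still_expectation:
  assumes "0 \<le> s" "0 \<le> h"
  shows "integrable M (\<lambda>\<omega>. of_bool (N (s + h) \<omega> = N s \<omega>) :: real)"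
    and "expectation (\<lambda>\<omega>. of_bool (N (s + h) \<omega> = N s \<omega>)) = exp (- l * h)"
proof -
  have one: "(\<lambda>_. 1 :: real) \<in> borel_measurable (history s)" "integrable M (\<lambda>_. 1 :: real)"
    by simp_all
  show "integrable M (\<lambda>\<omega>. of_bool (N (s + h) \<omega> = N s \<omega>) :: real)"
    using expectation_no_event(1)[OF assms one] by simp
  show "expectation (\<lambda>\<omega>. of_bool (N (s + h) \<omega> = N s \<omega>)) = exp (- l * h)"
    using expectation_no_event(2)[OF assms one] by (simp add: prob_space)
qed

text \<open>The pathwise estimates are integrated: rotation when no event occurs, creation of the
  value 1 when the first event is the return. The exponentials in \<open>h\<close> stay exact here;
  their expansion is a separate, deterministic matter.\<close>

lemma mean_cosh_step:
  assumes s: "0 \<le> s" and h: "0 \<le> h"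
  shows "\<bar>mean_cosh c k (s + h) - mean_cosh c k s
      - exp (- l * h) * (mean_cosh c k s * (cosh (c * h) - 1) + mean_sinh c k s * sinh (c * h))
      - (1 - exp (- l * h)) * prob {\<omega> \<in> space M. Suc (N s \<omega>) = k}\<bar>
    \<le> (1 - exp (- l * h)) * ((exp (c * h) - 1) * exp (c * s)) + (l * h)\<^sup>2 * exp (c * (s + h))"
proof -
  have [measurable]: "N s \<in> M \<rightarrow>\<^sub>M count_space UNIV" "N (s + h) \<in> M \<rightarrow>\<^sub>M count_space UNIV"
    "N s \<in> history s \<rightarrow>\<^sub>M count_space UNIV"
    using s h by auto
  let ?still = "\<lambda>\<omega>. of_bool (N (s + h) \<omega> = N s \<omega>) :: real"
  let ?C = "\<lambda>r \<omega>. return_cosh c k (\<lambda>n. T n \<omega>) r"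
  let ?D = "\<lambda>r \<omega>. return_sinh c k (\<lambda>n. T n \<omega>) r"
  define Z where "Z \<omega> = ?C s \<omega> * (cosh (c * h) - 1) + ?D s \<omega> * sinh (c * h)" for \<omega>
  note int = return_cosh_integrable[OF s, of k] return_sinh_integrable[OF s, of k]
  have intZ: "integrable M Z" unfolding Z_def using int by simp
  have EZ: "expectation Z = mean_cosh c k s * (cosh (c * h) - 1) + mean_sinh c k s * sinh (c * h)"
    unfolding Z_def mean_cosh_def mean_sinh_def using int by simp
  have "Z \<in> borel_measurable (history s)"
    unfolding Z_def using return_cosh_history[OF s] return_sinh_history[OF s] by measurable
  note stillZ = expectation_no_event[OF s h this intZ]
  let ?last = "\<lambda>\<omega>. of_bool (Suc (N s \<omega>) = k) :: real"
  let ?two = "\<lambda>\<omega>. of_bool (N s \<omega> + 2 \<le> N (s + h) \<omega>) :: real"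
  have last: "?last \<in> borel_measurable (history s)" by measurable
  have intL: "integrable M ?last"
    by (rule integrable_const_bound[of _ 1]) auto
  note stillL = expectation_no_event[OF s h last intL]
  have EL: "expectation ?last = prob {\<omega> \<in> space M. Suc (N s \<omega>) = k}"
    by (rule expectation_of_bool)
  have "(\<lambda>\<omega>. of_bool (2 \<le> N (s + h) \<omega> - N s \<omega>) :: real) \<in> borel_measurable M" by measurable
  also have "(\<lambda>\<omega>. of_bool (2 \<le> N (s + h) \<omega> - N s \<omega>)) = ?two"
    by (auto simp: fun_eq_iff of_bool_def)
  finally have int2: "integrable M ?two"
    by (rule integrable_const_bound[of _ 1, rotated]) auto
  have E2: "expectation ?two \<le> (l * h)\<^sup>2"
    using prob_two_events[OF s h] by (simp add: expectation_of_bool)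
  have int': "integrable M (?C (s + h))" using s h by (intro return_cosh_integrable) simp
  \<comment> \<open>The final difference indicates that some event occurs and the first one is the
    return. Written this way, each term is a factor known at time \<open>s\<close>, possibly times
    \<open>?still\<close>, so \<open>expectation_no_event\<close> applies.\<close>
  let ?f = "\<lambda>\<omega>. ?C (s + h) \<omega> - ?C s \<omega> - ?still \<omega> * Z \<omega> - (?last \<omega> - ?still \<omega> * ?last \<omega>)"
  let ?K = "(exp (c * h) - 1) * exp (c * s)"
  let ?g = "\<lambda>\<omega>. (1 - ?still \<omega>) * ?K + ?two \<omega> * exp (c * (s + h))"
  have bound: "\<bar>expectation ?f\<bar> \<le> expectation ?g"
  proof (rule abs_integral_le)
    show "integrable M ?f" using int int' stillZ(1) stillL(1) intL by simp
    show "integrable M ?g" using still_expectation(1)[OF s h] int2 by simp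
    fix \<omega> assume \<omega>: "\<omega> \<in> space M"
    interpret event_path "\<lambda>n. T n \<omega>" by (rule path[OF \<omega>])
    show "\<bar>?f \<omega>\<bar> \<le> ?g \<omega>"
    proof (cases "N (s + h) \<omega> = N s \<omega>")
      case True
      then show ?thesis
        using return_cosh_step[OF c s h, of k] by (simp add: N_def Z_def algebra_simps)
    next
      case False
      then have "N s \<omega> < N (s + h) \<omega>" using N_mono[OF \<omega> s, of "s + h"] h by simp
      then show ?thesis
        using return_cosh_event[OF c s h, of k] False by (simp add: N_def)
    qed
  qed
  have f: "expectation ?f = mean_cosh c k (s + h) - mean_cosh c k s
      - exp (- l * h) * expectation Z - (expectation ?last - exp (- l * h) * expectation ?last)"
    using int int' stillZ stillL intL by (simp add: mean_cosh_def)
  have g: "expectation ?g = (1 - exp (- l * h)) * ?K + expectation ?two * exp (c * (s + h))"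
    using still_expectation[OF s h] int2 by (simp add: prob_space)
  have "expectation ?two * exp (c * (s + h)) \<le> (l * h)\<^sup>2 * exp (c * (s + h))"
    using E2 by (intro mult_right_mono) auto
  with bound have "\<bar>expectation ?f\<bar> \<le> (1 - exp (- l * h)) * ?K + (l * h)\<^sup>2 * exp (c * (s + h))"
    unfolding g by linarith
  then show ?thesis
    unfolding f EZ EL left_diff_distrib[of 1 _ "prob _"] mult_1 .
qed

text \<open>An event contributes to the error only: it resets the current leg, so what remains is
  the bound of \<open>return_sinh_event\<close> weighted by the probability of an event.\<close>

lemma mean_sinh_step:
  assumes s: "0 \<le> s" and h: "0 \<le> h"
  shows "\<bar>mean_sinh c k (s + h) - exp (- l * h) * (mean_sinh c k s * cosh (c * h) + mean_cosh c k s * sinh (c * h))\<bar>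
    \<le> (1 - exp (- l * h)) * (sinh (c * h) * exp (c * (s + h)))"
proof -
  have [measurable]: "N s \<in> M \<rightarrow>\<^sub>M count_space UNIV" "N (s + h) \<in> M \<rightarrow>\<^sub>M count_space UNIV"
    "N s \<in> history s \<rightarrow>\<^sub>M count_space UNIV"
    using s h by auto
  let ?still = "\<lambda>\<omega>. of_bool (N (s + h) \<omega> = N s \<omega>) :: real"
  let ?C = "\<lambda>r \<omega>. return_cosh c k (\<lambda>n. T n \<omega>) r"
  let ?D = "\<lambda>r \<omega>. return_sinh c k (\<lambda>n. T n \<omega>) r"
  define Z where "Z \<omega> = ?D s \<omega> * cosh (c * h) + ?C s \<omega> * sinh (c * h)" for \<omega>
  note int = return_cosh_integrable[OF s, of k] return_sinh_integrable[OF s, of k]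
  have intZ: "integrable M Z" unfolding Z_def using int by simp
  have EZ: "expectation Z = mean_sinh c k s * cosh (c * h) + mean_cosh c k s * sinh (c * h)"
    unfolding Z_def mean_cosh_def mean_sinh_def using int by simp
  have "Z \<in> borel_measurable (history s)"
    unfolding Z_def using return_cosh_history[OF s] return_sinh_history[OF s] by measurable
  note stillZ = expectation_no_event[OF s h this intZ]
  have int': "integrable M (?D (s + h))" using s h by (intro return_sinh_integrable) simp
  let ?f = "\<lambda>\<omega>. ?D (s + h) \<omega> - ?still \<omega> * Z \<omega>"
  let ?g = "\<lambda>\<omega>. (1 - ?still \<omega>) * (sinh (c * h) * exp (c * (s + h)))"
  have bound: "\<bar>expectation ?f\<bar> \<le> expectation ?g"
  proof (rule abs_integral_le)
    show "integrable M ?f" using int' stillZ(1) by simp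
    show "integrable M ?g" using still_expectation(1)[OF s h] by simp
    fix \<omega> assume \<omega>: "\<omega> \<in> space M"
    interpret event_path "\<lambda>n. T n \<omega>" by (rule path[OF \<omega>])
    show "\<bar>?f \<omega>\<bar> \<le> ?g \<omega>"
    proof (cases "N (s + h) \<omega> = N s \<omega>")
      case True
      then show ?thesis
        using return_sinh_step[OF c s h, of k] by (simp add: N_def Z_def)
    next
      case False
      then have "N s \<omega> < N (s + h) \<omega>" using N_mono[OF \<omega> s, of "s + h"] h by simp
      then show ?thesis
        using return_sinh_event[OF c s h, of k] return_sinh_nonneg[OF c, of "s + h" k] s h False
        by (simp add: N_def)
    qed
  qed
  have f: "expectation ?f = mean_sinh c k (s + h) - exp (- l * h) * expectation Z"
    using int' stillZ by (simp add: mean_sinh_def)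
  have g: "expectation ?g = (1 - exp (- l * h)) * (sinh (c * h) * exp (c * (s + h)))"
    using still_expectation[OF s h] by (simp add: prob_space)
  show ?thesis using bound unfolding f g EZ .
qed

end

end

section \<open>A linear system of differential equations\<close>

text \<open>The estimate looks forward, but with one constant for all base points; a left neighbour
  of \<open>s\<close> is treated by stepping from it to \<open>s\<close>.\<close>

lemma continuous_on_from_steps:
  fixes f :: "real \<Rightarrow> real"
  assumes "\<delta> > 0"
    and step: "\<And>s h. 0 \<le> s \<Longrightarrow> 0 < h \<Longrightarrow> h < \<delta> \<Longrightarrow> s + h \<le> R \<Longrightarrow> \<bar>f (s + h) - f s\<bar> \<le> K * h"
  shows "continuous_on {0..R} f"
  unfolding continuous_on_def
proof
  fix s assume s: "s \<in> {0..R}"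
  have "\<forall>\<^sub>F y in at s within {0..R}. norm (f y - f s) \<le> K * \<bar>y - s\<bar>"
    unfolding eventually_at
  proof (intro exI[of _ \<delta>] conjI ballI impI)
    fix y assume y: "y \<in> {0..R}" "y \<noteq> s \<and> dist y s < \<delta>"
    show "norm (f y - f s) \<le> K * \<bar>y - s\<bar>"
    proof (cases "s < y")
      case True
      then show ?thesis using step[of s "y - s"] s y by (simp add: dist_real_def)
    next
      case False
      then show ?thesis using step[of y "s - y"] s y by (simp add: dist_real_def abs_minus_commute)
    qed
  qed (use assms(1) in simp)
  moreover have "((\<lambda>y. K * \<bar>y - s\<bar>) \<longlongrightarrow> K * \<bar>s - s\<bar>) (at s within {0..R})"
    by (intro tendsto_intros)
  then have "((\<lambda>y. K * \<bar>y - s\<bar>) \<longlongrightarrow> 0) (at s within {0..R})" by simp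
  ultimately have "((\<lambda>y. f y - f s) \<longlongrightarrow> 0) (at s within {0..R})"
    by (rule Lim_null_comparison)
  then show "(f \<longlongrightarrow> f s) (at s within {0..R})" by (rule LIM_zero_cancel)
qed

text \<open>Stepping up to \<open>s\<close> from a left neighbour \<open>y\<close> compares the
  quotient with \<open>g y\<close> instead of \<open>g s\<close>; continuity of \<open>g\<close>
  closes this gap and yields the two-sided derivative.\<close>

lemma has_real_derivative_from_steps:
  fixes f g :: "real \<Rightarrow> real"
  assumes "\<delta> > 0"
    and step: "\<And>s h. 0 \<le> s \<Longrightarrow> 0 < h \<Longrightarrow> h < \<delta> \<Longrightarrow> s + h \<le> R \<Longrightarrow>
      \<bar>f (s + h) - f s - h * g s\<bar> \<le> K * h\<^sup>2"
    and g: "continuous_on {0..R} g" and s: "s \<in> {0..R}"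
  shows "(f has_real_derivative g s) (at s within {0..R})"
proof -
  have quotient: "\<bar>(f (r + h) - f r) / h - g r\<bar> \<le> K * h"
    if "0 \<le> r" "0 < h" "h < \<delta>" "r + h \<le> R" for r h
  proof -
    have "(f (r + h) - f r) / h - g r = (f (r + h) - f r - h * g r) / h"
      using that by (simp add: diff_divide_distrib)
    then have "\<bar>(f (r + h) - f r) / h - g r\<bar> = \<bar>f (r + h) - f r - h * g r\<bar> / h"
      using that by (simp only: abs_divide abs_of_pos)
    also have "\<dots> \<le> K * h\<^sup>2 / h" using step[OF that] that by (intro divide_right_mono) auto
    finally show ?thesis using that by (simp add: power2_eq_square)
  qed
  have "\<forall>\<^sub>F y in at s within {0..R}.
      norm ((f y - f s) / (y - s) - g s) \<le> \<bar>g y - g s\<bar> + K * \<bar>y - s\<bar>"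
    unfolding eventually_at
  proof (intro exI[of _ \<delta>] conjI ballI impI)
    fix y assume y: "y \<in> {0..R}" "y \<noteq> s \<and> dist y s < \<delta>"
    show "norm ((f y - f s) / (y - s) - g s) \<le> \<bar>g y - g s\<bar> + K * \<bar>y - s\<bar>"
    proof (cases "s < y")
      case True
      then have "\<bar>(f y - f s) / (y - s) - g s\<bar> \<le> K * (y - s)"
        using quotient[of s "y - s"] s y by (simp add: dist_real_def)
      moreover have "\<bar>y - s\<bar> = y - s" using True by simp
      ultimately show ?thesis by simp
    next
      case False
      have e1: "(f y - f s) / (y - s) = (f s - f y) / (s - y)"
        by (rule minus_divide_divide[of "f s - f y" "s - y", unfolded minus_diff_eq])
      have e2: "\<bar>(f s - f y) / (s - y) - g y\<bar> \<le> K * (s - y)"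
        using quotient[of y "s - y"] s y False by (simp add: dist_real_def)
      have e3: "\<bar>y - s\<bar> = s - y" using False by simp
      show ?thesis using e2 unfolding real_norm_def e1 e3 by linarith
    qed
  qed (use assms(1) in simp)
  moreover have "(g \<longlongrightarrow> g s) (at s within {0..R})"
    using g s unfolding continuous_on_def by blast
  then have "((\<lambda>y. \<bar>g y - g s\<bar> + K * \<bar>y - s\<bar>) \<longlongrightarrow> \<bar>g s - g s\<bar> + K * \<bar>s - s\<bar>) (at s within {0..R})"
    by (intro tendsto_intros)
  then have "((\<lambda>y. \<bar>g y - g s\<bar> + K * \<bar>y - s\<bar>) \<longlongrightarrow> 0) (at s within {0..R})" by simp
  ultimately have "((\<lambda>y. (f y - f s) / (y - s) - g s) \<longlongrightarrow> 0) (at s within {0..R})"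
    by (rule Lim_null_comparison)
  then show ?thesis unfolding has_field_derivative_iff by (rule LIM_zero_cancel)
qed

text \<open>Energy estimate: the derivative of the sum of the squares is 4 c d e - 2 l e e, and 2 d
  e is at most the sum of the squares. Damping the energy by \<open>exp (- (2 * c * x))\<close>
  therefore makes it nonincreasing, and it starts at 0.\<close>

lemma linear_system_unique:
  fixes d e :: "real \<Rightarrow> real"
  assumes R: "0 \<le> R" and l: "0 \<le> l" and c: "0 \<le> c"
    and d: "\<And>x. x \<in> {0..R} \<Longrightarrow> (d has_real_derivative c * e x) (at x within {0..R})"
    and e: "\<And>x. x \<in> {0..R} \<Longrightarrow> (e has_real_derivative c * d x - l * e x) (at x within {0..R})"
    and init: "d 0 = 0" "e 0 = 0"
  shows "d R = 0"
proof -
  define w where "w x = ((d x)\<^sup>2 + (e x)\<^sup>2) * exp (- (2 * c * x))" for x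
  define w' where "w' x = - (2 * c * (d x - e x)\<^sup>2 + 2 * l * (e x)\<^sup>2) * exp (- (2 * c * x))" for x
  have w': "(w has_real_derivative w' x) (at x within {0..R})" if "x \<in> {0..R}" for x
    unfolding w_def w'_def
    by (rule derivative_eq_intros d[OF that] e[OF that] refl)+
      (simp add: power2_eq_square algebra_simps)
  have "w R \<le> w 0"
  proof (rule DERIV_nonpos_imp_decreasing_open[OF R])
    fix x assume x: "0 < x" "x < R"
    then have "(w has_real_derivative w' x) (at x)" using w'[of x] by (simp add: at_within_Icc_at)
    moreover have "0 \<le> c * (d x - e x)\<^sup>2" "0 \<le> l * (e x)\<^sup>2" using l c by simp_all
    then have "w' x \<le> 0" unfolding w'_def by (intro mult_nonpos_nonneg) auto
    ultimately show "\<exists>y. (w has_real_derivative y) (at x) \<and> y \<le> 0" by blast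
  next
    show "continuous_on {0..R} w" by (rule DERIV_continuous_on[OF w'])
  qed
  then have "(d R)\<^sup>2 + (e R)\<^sup>2 \<le> 0" by (simp add: w_def init mult_le_0_iff)
  then have "(d R)\<^sup>2 \<le> 0" using zero_le_power2[of "e R"] by linarith
  then show ?thesis by simp
qed

section \<open>Taylor remainders of the exponential function and their asymptotics\<close>

text \<open>For nonzero \<open>a\<close> this is the \<open>n\<close>-fold iterated integral from 0
  of the function exp (a x). The division by the power of \<open>a\<close> makes differentiation
  simply lower \<open>n\<close>.\<close>

definition exp_rem :: "nat \<Rightarrow> real \<Rightarrow> real \<Rightarrow> real" where
  "exp_rem n a x = (exp (a * x) - (\<Sum>m<n. (a * x) ^ m / fact m)) / a ^ n"

lemma exp_rem_Suc: "a \<noteq> 0 \<Longrightarrow> exp_rem n a x = x ^ n / fact n + a * exp_rem (Suc n) a x"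
  by (simp add: exp_rem_def field_simps power_mult_distrib)

lemma exp_rem_0_right: "exp_rem (Suc n) a 0 = 0"
proof -
  have "(\<Sum>m<Suc n. (0::real) ^ m / fact m) = 1" by (induction n) auto
  then show ?thesis by (simp add: exp_rem_def del: sum.lessThan_Suc)
qed

lemma DERIV_exp_rem_Suc:
  assumes "a \<noteq> 0"
  shows "(exp_rem (Suc n) a has_real_derivative exp_rem n a x) (at x within X)"
proof (induction n)
  case 0
  show ?case unfolding exp_rem_def[abs_def]
    by (auto intro!: derivative_eq_intros simp: assms)
next
  case (Suc n)
  have "exp_rem (Suc (Suc n)) a = (\<lambda>x. (exp_rem (Suc n) a x - x ^ Suc n / fact (Suc n)) / a)"
    using exp_rem_Suc[OF assms, of "Suc n"] assms by (auto simp: fun_eq_iff field_simps)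
  moreover have "((\<lambda>x. x ^ Suc n / fact (Suc n)) has_real_derivative x ^ n / fact n) (at x within X)"
    using DERIV_cdivide[OF DERIV_pow[of "Suc n" x X], of "fact (Suc n)"] by simp
  then have "((\<lambda>x. (exp_rem (Suc n) a x - x ^ Suc n / fact (Suc n)) / a) has_real_derivative
      (exp_rem n a x - x ^ n / fact n) / a) (at x within X)"
    by (intro DERIV_cdivide DERIV_diff Suc)
  ultimately show ?case
    using exp_rem_Suc[OF assms, of n x] assms by simp
qed

lemma DERIV_exp_rem:
  assumes "a \<noteq> 0"
  shows "(exp_rem n a has_real_derivative
    a * exp_rem n a x + (if n = 0 then 0 else x ^ (n - 1) / fact (n - 1))) (at x within X)"
proof (cases n)
  case 0
  show ?thesis unfolding exp_rem_def[abs_def] 0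
    by (auto intro!: derivative_eq_intros)
next
  case (Suc m)
  then show ?thesis using DERIV_exp_rem_Suc[OF assms, of m x X] exp_rem_Suc[OF assms, of m x]
    by (simp add: add.commute)
qed

lemma exp_rem_eq_sum:
  assumes "a \<noteq> 0"
  shows "exp_rem n a x = exp (a * x) / a ^ n - (\<Sum>i = 1..n. 1 / a ^ i * x ^ (n - i) / fact (n - i))"
proof -
  have "(\<Sum>m<n. (a * x) ^ m / fact m / a ^ n) = (\<Sum>i = 1..n. 1 / a ^ i * x ^ (n - i) / fact (n - i))"
  \<comment> \<open>Degree \<open>m\<close> of the Taylor polynomial corresponds to
    \<open>i = n - m\<close>, since dividing by \<open>a ^ n\<close> leaves \<open>a ^ i\<close> in
    the denominator.\<close>
  proof (rule sum.reindex_bij_witness[of _ "\<lambda>i. n - i" "\<lambda>m. n - m"])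
    fix m assume "m \<in> {..<n}"
    moreover from this have "a ^ n = a ^ m * a ^ (n - m)" by (simp flip: power_add)
    ultimately show "1 / a ^ (n - m) * x ^ (n - (n - m)) / fact (n - (n - m)) = (a * x) ^ m / fact m / a ^ n"
      using assms by (simp add: power_mult_distrib)
  qed auto
  then show ?thesis
    by (simp add: exp_rem_def diff_divide_distrib sum_divide_distrib)
qed

text \<open>The six expressions are the factors depending on \<open>h\<close> alone in the errors of
  the two evolution steps. Their bounds involve no base point, which is the source of the uniformity
  in \<open>s\<close>.\<close>

lemma quadratic_remainders:
  fixes l c :: real
  assumes "l > 0" "c > 0"
  obtains K \<delta> where "K \<ge> 0" "\<delta> > 0"
    "\<forall>h. 0 < h \<and> h < \<delta> \<longrightarrow> \<bar>exp (- l * h) * (cosh (c * h) - 1)\<bar> \<le> K * h\<^sup>2"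
    "\<forall>h. 0 < h \<and> h < \<delta> \<longrightarrow> \<bar>exp (- l * h) * sinh (c * h) - c * h\<bar> \<le> K * h\<^sup>2"
    "\<forall>h. 0 < h \<and> h < \<delta> \<longrightarrow> \<bar>1 - exp (- l * h) - l * h\<bar> \<le> K * h\<^sup>2"
    "\<forall>h. 0 < h \<and> h < \<delta> \<longrightarrow> \<bar>(1 - exp (- l * h)) * (exp (c * h) - 1)\<bar> \<le> K * h\<^sup>2"
    "\<forall>h. 0 < h \<and> h < \<delta> \<longrightarrow> \<bar>exp (- l * h) * cosh (c * h) - 1 + l * h\<bar> \<le> K * h\<^sup>2"
    "\<forall>h. 0 < h \<and> h < \<delta> \<longrightarrow> \<bar>(1 - exp (- l * h)) * sinh (c * h)\<bar> \<le> K * h\<^sup>2"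
proof -
  have f1: "(\<lambda>h. exp (- l * h) * (cosh (c * h) - 1)) \<in> O[at_right 0](\<lambda>h. h\<^sup>2)"
    unfolding cosh_field_def using assms by real_asymp
  have f2: "(\<lambda>h. exp (- l * h) * sinh (c * h) - c * h) \<in> O[at_right 0](\<lambda>h. h\<^sup>2)"
    unfolding sinh_field_def using assms by real_asymp
  have f3: "(\<lambda>h. 1 - exp (- l * h) - l * h) \<in> O[at_right 0](\<lambda>h. h\<^sup>2)"
    using assms by real_asymp
  have f4: "(\<lambda>h. (1 - exp (- l * h)) * (exp (c * h) - 1)) \<in> O[at_right 0](\<lambda>h. h\<^sup>2)"
    using assms by real_asymp
  have f5: "(\<lambda>h. exp (- l * h) * cosh (c * h) - 1 + l * h) \<in> O[at_right 0](\<lambda>h. h\<^sup>2)"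
    unfolding cosh_field_def using assms by real_asymp
  have f6: "(\<lambda>h. (1 - exp (- l * h)) * sinh (c * h)) \<in> O[at_right 0](\<lambda>h. h\<^sup>2)"
    unfolding sinh_field_def using assms by real_asymp
  \<comment> \<open>Adding the absolute values gives a single asymptotic bound and hence one common
    \<open>K\<close> and \<open>\<delta>\<close>.\<close>
  define g where "g h = \<bar>exp (- l * h) * (cosh (c * h) - 1)\<bar> + \<bar>exp (- l * h) * sinh (c * h) - c * h\<bar>
    + \<bar>1 - exp (- l * h) - l * h\<bar> + \<bar>(1 - exp (- l * h)) * (exp (c * h) - 1)\<bar>
    + \<bar>exp (- l * h) * cosh (c * h) - 1 + l * h\<bar> + \<bar>(1 - exp (- l * h)) * sinh (c * h)\<bar>" for h
  have "g \<in> O[at_right 0](\<lambda>h. h\<^sup>2)"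
    unfolding g_def[abs_def]
    by (intro sum_in_bigo landau_o.big.abs_in_iff[THEN iffD2] f1 f2 f3 f4 f5 f6)
  then obtain K where K: "0 < K" "\<forall>\<^sub>F h in at_right 0. norm (g h) \<le> K * norm (h\<^sup>2)"
    by (rule landau_o.bigE)
  then obtain \<delta> where \<delta>: "\<delta> > 0" "\<forall>h>0. h < \<delta> \<longrightarrow> norm (g h) \<le> K * norm (h\<^sup>2)"
    unfolding eventually_at_right_field by blast
  have all: "\<bar>exp (- l * h) * (cosh (c * h) - 1)\<bar> \<le> K * h\<^sup>2 \<and> \<bar>exp (- l * h) * sinh (c * h) - c * h\<bar> \<le> K * h\<^sup>2
        \<and> \<bar>1 - exp (- l * h) - l * h\<bar> \<le> K * h\<^sup>2 \<and> \<bar>(1 - exp (- l * h)) * (exp (c * h) - 1)\<bar> \<le> K * h\<^sup>2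
        \<and> \<bar>exp (- l * h) * cosh (c * h) - 1 + l * h\<bar> \<le> K * h\<^sup>2 \<and> \<bar>(1 - exp (- l * h)) * sinh (c * h)\<bar> \<le> K * h\<^sup>2" if h: "0 < h" "h < \<delta>" for h
  proof -
    have gh: "g h \<le> K * h\<^sup>2" using \<delta>(2)[rule_format, OF h] by simp
    note gh = gh[unfolded g_def]
    have aux: "a1 \<le> s \<and> a2 \<le> s \<and> a3 \<le> s \<and> a4 \<le> s \<and> a5 \<le> s \<and> a6 \<le> s"
      if "a1 + a2 + a3 + a4 + a5 + a6 \<le> s" "0 \<le> a1" "0 \<le> a2" "0 \<le> a3" "0 \<le> a4" "0 \<le> a5" "0 \<le> a6"
      for a1 a2 a3 a4 a5 a6 s :: real
      using that by linarith
    show ?thesis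
      by (rule aux[OF gh]; rule abs_ge_zero)
  qed
  show ?thesis
    by (rule that[OF less_imp_le[OF K(1)] \<delta>(1)]) (use all in blast)+
qed

section \<open>The mean hyperbolic cosine\<close>

context poisson_events
begin

context
  fixes c :: real
  assumes c: "c > 0"
begin

lemma mean_bounds:
  assumes s: "0 \<le> s" "s \<le> R"
  shows "\<bar>mean_cosh c k s\<bar> \<le> exp (c * R)" "\<bar>mean_sinh c k s\<bar> \<le> exp (c * R)"
proof -
  have "exp (c * s) \<le> exp (c * R)" using s c by simp
  then have le: "\<bar>return_cosh c k (\<lambda>n. T n \<omega>) s\<bar> \<le> exp (c * R)" "\<bar>return_sinh c k (\<lambda>n. T n \<omega>) s\<bar> \<le> exp (c * R)"
    if "\<omega> \<in> space M" for \<omega>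
    using return_bounds[OF c that s(1), of k] by linarith+
  show "\<bar>mean_cosh c k s\<bar> \<le> exp (c * R)"
  proof -
    have "\<bar>mean_cosh c k s\<bar> \<le> expectation (\<lambda>_. exp (c * R))"
      unfolding mean_cosh_def
      by (rule abs_integral_le[OF return_cosh_integrable[OF c s(1)] integrable_const le(1)])
    then show ?thesis by (simp add: prob_space)
  qed
  show "\<bar>mean_sinh c k s\<bar> \<le> exp (c * R)"
  proof -
    have "\<bar>mean_sinh c k s\<bar> \<le> expectation (\<lambda>_. exp (c * R))"
      unfolding mean_sinh_def
      by (rule abs_integral_le[OF return_sinh_integrable[OF c s(1)] integrable_const le(2)])
    then show ?thesis by (simp add: prob_space)
  qed
qed

text \<open>At time 0 no event has occurred, so with \<open>k \<ge> 1\<close> the return is still to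
  come.\<close>

lemma mean_0:
  assumes "k \<ge> 1"
  shows "mean_cosh c k 0 = 0" "mean_sinh c k 0 = 0"
proof -
  have zero: "return_cosh c k (\<lambda>n. T n \<omega>) 0 = 0" "return_sinh c k (\<lambda>n. T n \<omega>) 0 = 0" if "\<omega> \<in> space M" for \<omega>
    using event_path.num_events_0[OF path[OF that]] assms by (simp_all add: return_cosh_def return_sinh_def)
  have "mean_cosh c k 0 = expectation (\<lambda>_. 0)"
    unfolding mean_cosh_def by (rule Bochner_Integration.integral_cong) (simp_all add: zero)
  then show "mean_cosh c k 0 = 0" by simp
  have "mean_sinh c k 0 = expectation (\<lambda>_. 0)"
    unfolding mean_sinh_def by (rule Bochner_Integration.integral_cong) (simp_all add: zero)
  then show "mean_sinh c k 0 = 0" by simp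
qed

lemma mean_steps:
  assumes R: "0 \<le> R"
  obtains K \<delta> where "K \<ge> 0" "\<delta> > 0"
    "\<forall>s h. 0 \<le> s \<and> 0 < h \<and> h < \<delta> \<and> s + h \<le> R \<longrightarrow>
      \<bar>mean_cosh c k (s + h) - mean_cosh c k s
        - h * (c * mean_sinh c k s + l * prob {\<omega> \<in> space M. Suc (N s \<omega>) = k})\<bar> \<le> K * h\<^sup>2"
    "\<forall>s h. 0 \<le> s \<and> 0 < h \<and> h < \<delta> \<and> s + h \<le> R \<longrightarrow>
      \<bar>mean_sinh c k (s + h) - mean_sinh c k s
        - h * (c * mean_cosh c k s - l * mean_sinh c k s)\<bar> \<le> K * h\<^sup>2"
proof -
  obtain K \<delta> where K: "K \<ge> 0" "\<delta> > 0"
    and q: "\<forall>h. 0 < h \<and> h < \<delta> \<longrightarrow> \<bar>exp (- l * h) * (cosh (c * h) - 1)\<bar> \<le> K * h\<^sup>2"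
    "\<forall>h. 0 < h \<and> h < \<delta> \<longrightarrow> \<bar>exp (- l * h) * sinh (c * h) - c * h\<bar> \<le> K * h\<^sup>2"
    "\<forall>h. 0 < h \<and> h < \<delta> \<longrightarrow> \<bar>1 - exp (- l * h) - l * h\<bar> \<le> K * h\<^sup>2"
    "\<forall>h. 0 < h \<and> h < \<delta> \<longrightarrow> \<bar>(1 - exp (- l * h)) * (exp (c * h) - 1)\<bar> \<le> K * h\<^sup>2"
    "\<forall>h. 0 < h \<and> h < \<delta> \<longrightarrow> \<bar>exp (- l * h) * cosh (c * h) - 1 + l * h\<bar> \<le> K * h\<^sup>2"
    "\<forall>h. 0 < h \<and> h < \<delta> \<longrightarrow> \<bar>(1 - exp (- l * h)) * sinh (c * h)\<bar> \<le> K * h\<^sup>2"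
    by (rule quadratic_remainders[OF rate_pos c])
  define E where "E = exp (c * R)"
  have E: "1 \<le> E" using c R by (simp add: E_def)
  have mult_le: "\<bar>x * y\<bar> \<le> K * h\<^sup>2 * E" if "\<bar>x\<bar> \<le> K * h\<^sup>2" "\<bar>y\<bar> \<le> E" for x y h
    unfolding abs_mult using that K by (intro mult_mono) auto
  have tri: "\<bar>w + x + y + z\<bar> \<le> \<alpha> + \<beta> + \<gamma> + \<epsilon>"
    if "\<bar>w\<bar> \<le> \<alpha>" "\<bar>x\<bar> \<le> \<beta>" "\<bar>y\<bar> \<le> \<gamma>" "\<bar>z\<bar> \<le> \<epsilon>" for w x y z \<alpha> \<beta> \<gamma> \<epsilon> :: real
    using that by linarith
  \<comment> \<open>The constant collects four remainders of size \<open>K\<close> and the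
    probability of two events, which contributes the square of \<open>l\<close>; \<open>E\<close>
    bounds all factors depending on \<open>s\<close>. The second estimate has only three remainders
    and no two-event term.\<close>
  have steps: "\<bar>mean_cosh c k (s + h) - mean_cosh c k s
        - h * (c * mean_sinh c k s + l * prob {\<omega> \<in> space M. Suc (N s \<omega>) = k})\<bar> \<le> (4 * K + l\<^sup>2) * E * h\<^sup>2"
    "\<bar>mean_sinh c k (s + h) - mean_sinh c k s
        - h * (c * mean_cosh c k s - l * mean_sinh c k s)\<bar> \<le> (4 * K + l\<^sup>2) * E * h\<^sup>2"
    if h: "0 \<le> s" "0 < h" "h < \<delta>" "s + h \<le> R" for s h
  proof -
    define u v p where "u = mean_cosh c k s" and "v = mean_sinh c k s"
      and "p = prob {\<omega> \<in> space M. Suc (N s \<omega>) = k}"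
    have b: "\<bar>u\<bar> \<le> E" "\<bar>v\<bar> \<le> E" "\<bar>p\<bar> \<le> E" "\<bar>exp (c * s)\<bar> \<le> E" "exp (c * (s + h)) \<le> E"
      "\<bar>exp (c * (s + h))\<bar> \<le> E"
      using mean_bounds[of s R k] h E c prob_le_1[of "{\<omega> \<in> space M. Suc (N s \<omega>) = k}"]
      by (auto simp: u_def v_def p_def E_def intro: order_trans)
    note q = q[rule_format, OF conjI[OF h(2,3)]]
    note m = mult_le[OF q(1) b(1)] mult_le[OF q(2) b(2)] mult_le[OF q(3) b(3)]
      mult_le[OF q(4) b(4)] mult_le[OF q(5) b(2)] mult_le[OF q(2) b(1)] mult_le[OF q(6) b(6)]
    have m8: "(l * h)\<^sup>2 * exp (c * (s + h)) \<le> l\<^sup>2 * h\<^sup>2 * E"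
      unfolding power_mult_distrib using b(5) by (intro mult_left_mono) auto
    have "0 \<le> K * h\<^sup>2 * E" "0 \<le> l\<^sup>2 * h\<^sup>2 * E" using K E by auto
    note pos = this
    have K_eq: "(4 * K + l\<^sup>2) * E * h\<^sup>2 = 4 * (K * h\<^sup>2 * E) + l\<^sup>2 * h\<^sup>2 * E"
      by (simp add: algebra_simps)
    show "\<bar>mean_cosh c k (s + h) - mean_cosh c k s
        - h * (c * mean_sinh c k s + l * prob {\<omega> \<in> space M. Suc (N s \<omega>) = k})\<bar> \<le> (4 * K + l\<^sup>2) * E * h\<^sup>2"
    proof -
      have "mean_cosh c k (s + h) - u - h * (c * v + l * p)
        = (mean_cosh c k (s + h) - u - exp (- l * h) * (u * (cosh (c * h) - 1) + v * sinh (c * h))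
            - (1 - exp (- l * h)) * p)
          + exp (- l * h) * (cosh (c * h) - 1) * u + (exp (- l * h) * sinh (c * h) - c * h) * v
          + (1 - exp (- l * h) - l * h) * p"
        by (simp add: algebra_simps)
      moreover have "\<bar>mean_cosh c k (s + h) - u - exp (- l * h) * (u * (cosh (c * h) - 1) + v * sinh (c * h))
            - (1 - exp (- l * h)) * p\<bar>
          \<le> (1 - exp (- l * h)) * (exp (c * h) - 1) * exp (c * s) + (l * h)\<^sup>2 * exp (c * (s + h))"
        using mean_cosh_step[OF c h(1) less_imp_le[OF h(2)], of k] by (simp add: u_def v_def p_def mult.assoc)
      moreover note tri[OF this m(1,2,3)]
      ultimately have "\<bar>mean_cosh c k (s + h) - u - h * (c * v + l * p)\<bar>
          \<le> (1 - exp (- l * h)) * (exp (c * h) - 1) * exp (c * s) + (l * h)\<^sup>2 * exp (c * (s + h))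
            + K * h\<^sup>2 * E + K * h\<^sup>2 * E + K * h\<^sup>2 * E"
        by simp
      with order_trans[OF abs_ge_self m(4)] m8 show ?thesis
        unfolding K_eq u_def v_def p_def by linarith
    qed
    show "\<bar>mean_sinh c k (s + h) - mean_sinh c k s
        - h * (c * mean_cosh c k s - l * mean_sinh c k s)\<bar> \<le> (4 * K + l\<^sup>2) * E * h\<^sup>2"
    proof -
      have "mean_sinh c k (s + h) - v - h * (c * u - l * v)
        = (mean_sinh c k (s + h) - exp (- l * h) * (v * cosh (c * h) + u * sinh (c * h)))
          + (exp (- l * h) * cosh (c * h) - 1 + l * h) * v + (exp (- l * h) * sinh (c * h) - c * h) * u"
        by (simp add: algebra_simps)
      moreover have "\<bar>mean_sinh c k (s + h) - exp (- l * h) * (v * cosh (c * h) + u * sinh (c * h))\<bar>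
          \<le> (1 - exp (- l * h)) * sinh (c * h) * exp (c * (s + h))"
        using mean_sinh_step[OF c h(1) less_imp_le[OF h(2)], of k] by (simp add: u_def v_def mult.assoc)
      \<comment> \<open>The second equation has one summand fewer; the fourth slot of
        \<open>tri\<close> is filled with 0.\<close>
      moreover note tri[OF this m(5,6) eq_refl[OF abs_zero]]
      ultimately have "\<bar>mean_sinh c k (s + h) - v - h * (c * u - l * v)\<bar>
          \<le> (1 - exp (- l * h)) * sinh (c * h) * exp (c * (s + h)) + K * h\<^sup>2 * E + K * h\<^sup>2 * E"
        by simp
      with order_trans[OF abs_ge_self m(7)] pos show ?thesis
        unfolding K_eq u_def v_def by linarith
    qed
  qed
  have "(4 * K + l\<^sup>2) * E \<ge> 0" using K E by simp
  then show ?thesis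
    by (rule that[OF _ K(2)]) (use steps in blast)+
qed

text \<open>A bootstrap: the step estimates with bounded right-hand sides make both means
  continuous, so the right-hand sides are continuous, and the same estimates then give the
  derivatives. The source comes from the Poisson probability of exactly \<open>k - 1\<close>
  events.\<close>

lemma mean_derivatives:
  assumes k: "k \<ge> 1" and x: "x \<in> {0..R}"
  shows "(mean_cosh c k has_real_derivative
      c * mean_sinh c k x + l * (exp (- l * x) * (l * x) ^ (k - 1) / fact (k - 1))) (at x within {0..R})"
    and "(mean_sinh c k has_real_derivative
      c * mean_cosh c k x - l * mean_sinh c k x) (at x within {0..R})"
proof -
  define p where "p s = prob {\<omega> \<in> space M. Suc (N s \<omega>) = k}" for s
  have p: "p s = exp (- l * s) * (l * s) ^ (k - 1) / fact (k - 1)" if "0 \<le> s" for s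
  proof -
    have "{\<omega> \<in> space M. Suc (N s \<omega>) = k} = {\<omega> \<in> space M. N s \<omega> = k - 1}" using k by auto
    then show ?thesis using prob_N[OF that] by (simp add: p_def)
  qed
  have "continuous_on {0..R} (\<lambda>s. exp (- l * s) * (l * s) ^ (k - 1) / fact (k - 1))"
    by (intro continuous_intros) auto
  then have contp: "continuous_on {0..R} p" by (rule continuous_on_eq) (simp add: p)
  have R: "0 \<le> R" using x by simp
  obtain K \<delta> where K: "K \<ge> 0" "\<delta> > 0" and steps:
    "\<forall>s h. 0 \<le> s \<and> 0 < h \<and> h < \<delta> \<and> s + h \<le> R \<longrightarrow>
      \<bar>mean_cosh c k (s + h) - mean_cosh c k s - h * (c * mean_sinh c k s + l * p s)\<bar> \<le> K * h\<^sup>2"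
    "\<forall>s h. 0 \<le> s \<and> 0 < h \<and> h < \<delta> \<and> s + h \<le> R \<longrightarrow>
      \<bar>mean_sinh c k (s + h) - mean_sinh c k s - h * (c * mean_cosh c k s - l * mean_sinh c k s)\<bar> \<le> K * h\<^sup>2"
    unfolding p_def by (rule mean_steps[OF R, of k])
  note steps = steps[rule_format, OF conjI[OF _ conjI[OF _ conjI]]]
  define E where "E = exp (c * R)"
  define G where "G = (c + l) * E"
  have E: "1 \<le> E" using c R by (simp add: E_def)
  have g: "\<bar>c * mean_sinh c k s + l * p s\<bar> \<le> G" "\<bar>c * mean_cosh c k s - l * mean_sinh c k s\<bar> \<le> G"
    if "0 \<le> s" "s \<le> R" for s
  proof -
    have "\<bar>p s\<bar> \<le> E" using order_trans[OF prob_le_1 E] by (simp add: p_def)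
    then have "\<bar>c * mean_sinh c k s\<bar> \<le> c * E" "\<bar>c * mean_cosh c k s\<bar> \<le> c * E"
      "\<bar>l * mean_sinh c k s\<bar> \<le> l * E" "\<bar>l * p s\<bar> \<le> l * E"
      using mean_bounds[OF that, of k] c rate_pos
      unfolding abs_mult E_def by (auto intro!: mult_mono)
    then show "\<bar>c * mean_sinh c k s + l * p s\<bar> \<le> G" "\<bar>c * mean_cosh c k s - l * mean_sinh c k s\<bar> \<le> G"
      unfolding G_def distrib_right by linarith+
  qed
  \<comment> \<open>For \<open>h < \<delta>\<close> the quadratic error is at most
    \<open>K * \<delta> * h\<close>, so the increments are Lipschitz.\<close>
  have cont: "continuous_on {0..R} f"
    if step: "\<And>s h. 0 \<le> s \<Longrightarrow> 0 < h \<Longrightarrow> h < \<delta> \<Longrightarrow> s + h \<le> R \<Longrightarrow> \<bar>f (s + h) - f s - h * g s\<bar> \<le> K * h\<^sup>2"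
      and bound: "\<And>s. 0 \<le> s \<Longrightarrow> s \<le> R \<Longrightarrow> \<bar>g s\<bar> \<le> G" for f g :: "real \<Rightarrow> real"
  proof (rule continuous_on_from_steps[OF K(2)])
    fix s h assume h: "0 \<le> s" "0 < h" "h < \<delta>" "s + h \<le> R"
    have "\<bar>h * g s\<bar> \<le> h * G" using bound[of s] h by (simp add: abs_mult)
    moreover have "K * h\<^sup>2 \<le> K * \<delta> * h"
      unfolding power2_eq_square mult.assoc using K h by (intro mult_left_mono mult_right_mono) auto
    ultimately show "\<bar>f (s + h) - f s\<bar> \<le> (G + K * \<delta>) * h"
      using step[OF h] unfolding distrib_right mult.commute[of G] by linarith
  qed
  have contu: "continuous_on {0..R} (mean_cosh c k)" by (rule cont[OF steps(1) g(1)])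
  have contv: "continuous_on {0..R} (mean_sinh c k)" by (rule cont[OF steps(2) g(2)])
  have "(mean_cosh c k has_real_derivative c * mean_sinh c k x + l * p x) (at x within {0..R})"
  proof (rule has_real_derivative_from_steps[OF K(2) _ _ x])
    show "continuous_on {0..R} (\<lambda>s. c * mean_sinh c k s + l * p s)"
      by (intro continuous_intros contv contp)
  qed (rule steps(1))
  then show "(mean_cosh c k has_real_derivative
      c * mean_sinh c k x + l * (exp (- l * x) * (l * x) ^ (k - 1) / fact (k - 1))) (at x within {0..R})"
    using p x by simp
  show "(mean_sinh c k has_real_derivative
      c * mean_cosh c k x - l * mean_sinh c k x) (at x within {0..R})"
  proof (rule has_real_derivative_from_steps[OF K(2) _ _ x])
    show "continuous_on {0..R} (\<lambda>s. c * mean_cosh c k s - l * mean_sinh c k s)"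
      by (intro continuous_intros contu contv)
  qed (rule steps(2))
qed

text \<open>Writing u = exp (- l x) y and v = c exp (- l x) z turns the homogeneous system into z' =
  y and y' = l y + c c z. Its characteristic roots are \<open>A\<close> and \<open>B\<close>, and z'
  = y suggests consecutive remainders for y and z. The factor \<open>l ^ k / r\<close> matches the
  source, as the difference of the remainders produces it multiplied by A - B = r.\<close>

lemma mean_cosh_eq:
  fixes R :: real
  defines "r \<equiv> sqrt (l\<^sup>2 + 4 * c\<^sup>2)"
  defines "A \<equiv> (l + r) / 2" and "B \<equiv> (l - r) / 2"
  assumes k: "k \<ge> 1" and R: "0 \<le> R"
  shows "mean_cosh c k R = l ^ k * exp (- l * R) / r * (exp_rem (k - 1) A R - exp_rem (k - 1) B R)"
proof -
  have r2: "r\<^sup>2 = l\<^sup>2 + 4 * c\<^sup>2" by (simp add: r_def)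
  have "r > l" unfolding r_def using c by (intro real_less_rsqrt) simp
  then have r: "r > 0" "A \<noteq> 0" "B \<noteq> 0" using rate_pos by (auto simp: A_def B_def)
  have AB: "A + B = l" "A - B = r" "A * B = - c\<^sup>2"
    using r2 by (simp_all add: A_def B_def field_simps power2_eq_square)
  obtain n where n: "k = Suc n" using k by (cases k) auto
  define \<Phi> where "\<Phi> m x = exp_rem m A x - exp_rem m B x" for m x
  define U where "U x = l ^ k / r * (exp (- l * x) * \<Phi> n x)" for x
  define V where "V x = c * l ^ k / r * (exp (- l * x) * \<Phi> (Suc n) x)" for x
  have d\<Phi>_Suc: "(\<Phi> (Suc n) has_real_derivative \<Phi> n x) (at x within X)" for x X
    unfolding \<Phi>_def by (intro derivative_intros DERIV_exp_rem_Suc r)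
  have d\<Phi>: "(\<Phi> n has_real_derivative l * \<Phi> n x + c\<^sup>2 * \<Phi> (Suc n) x + r * x ^ n / fact n) (at x within X)" for x X
  proof -
    have "(\<Phi> n has_real_derivative A * exp_rem n A x - B * exp_rem n B x) (at x within X)"
      unfolding \<Phi>_def
      using DERIV_diff[OF DERIV_exp_rem[OF r(2), of n x X] DERIV_exp_rem[OF r(3), of n x X]] by simp
    \<comment> \<open>From A + B = l and A B = - c c: A a = l a - B q + c c a', and symmetrically
      for B b; subtraction leaves (A - B) q = r q.\<close>
    moreover have "A * a - B * b = l * (a - b) + c\<^sup>2 * (a' - b') + r * q"
      if "a = q + A * a'" "b = q + B * b'" for a b a' b' q
      using that AB by algebra
    from this[OF exp_rem_Suc[OF r(2)] exp_rem_Suc[OF r(3)]]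
    have "A * exp_rem n A x - B * exp_rem n B x
        = l * \<Phi> n x + c\<^sup>2 * \<Phi> (Suc n) x + r * (x ^ n / fact n)"
      unfolding \<Phi>_def .
    ultimately show ?thesis by simp
  qed
  have dexp: "((\<lambda>x. exp (- l * x)) has_real_derivative - l * exp (- l * x)) (at x within X)" for x X
    by (auto intro!: derivative_eq_intros)
  have dU: "(U has_real_derivative c * V x + l * (exp (- l * x) * (l * x) ^ n / fact n)) (at x within X)" for x X
    unfolding U_def V_def
    by (rule DERIV_cong[OF DERIV_cmult[OF DERIV_mult[OF dexp d\<Phi>]]])
      (use r in \<open>simp add: n field_simps power2_eq_square power_mult_distrib\<close>)
  have dV: "(V has_real_derivative c * U x - l * V x) (at x within X)" for x X
    unfolding U_def V_def
    by (rule DERIV_cong[OF DERIV_cmult[OF DERIV_mult[OF dexp d\<Phi>_Suc]]])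
      (use r in \<open>simp add: field_simps\<close>)
  \<comment> \<open>For \<open>n = 0\<close> the two remainders are both 1 at the origin and cancel;
    for larger order each vanishes.\<close>
  have \<Phi>0: "\<Phi> n 0 = 0" "\<Phi> (Suc n) 0 = 0"
    by (cases n) (simp_all add: \<Phi>_def exp_rem_0_right, simp add: exp_rem_def)
  have "mean_cosh c k R - U R = 0"
  proof (rule linear_system_unique[OF R, where d = "\<lambda>x. mean_cosh c k x - U x" and e = "\<lambda>x. mean_sinh c k x - V x"])
    fix x assume x: "x \<in> {0..R}"
    show "((\<lambda>x. mean_cosh c k x - U x) has_real_derivative c * (mean_sinh c k x - V x)) (at x within {0..R})"
      using DERIV_diff[OF mean_derivatives(1)[OF k x] dU] by (simp add: n algebra_simps)
    show "((\<lambda>x. mean_sinh c k x - V x) has_real_derivative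
        c * (mean_cosh c k x - U x) - l * (mean_sinh c k x - V x)) (at x within {0..R})"
      using DERIV_diff[OF mean_derivatives(2)[OF k x] dV] by (simp add: algebra_simps)
  qed (use c rate_pos mean_0[OF k] \<Phi>0 in \<open>auto simp: U_def V_def\<close>)
  then show ?thesis by (simp add: U_def \<Phi>_def n)
qed

end

end

text \<open>Conditioning on an event of positive probability is integration against
  \<open>uniform_measure\<close>. Integrability is asserted too, as the integral of a non-integrable
  function is 0 by default.\<close>

theorem theorem5p2:
  fixes M :: "'a measure" and T :: "nat \<Rightarrow> 'a \<Rightarrow> real" and b :: "nat \<Rightarrow> 'a \<Rightarrow> bool"
    and l c t :: real and k :: nat
    and N :: "real \<Rightarrow> 'a \<Rightarrow> nat" and \<eta> :: "nat \<Rightarrow> real \<Rightarrow> 'a \<Rightarrow> real" and A B :: real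
  assumes "prob_space M"
    and "prob_space.poisson_event_times M l T"
    and "prob_space.fair_coins M T b"
    and "l > 0" and "c > 0" and "t > 0" and "k \<ge> 1"
  defines "N \<equiv> \<lambda>s \<omega>. num_events (\<lambda>n. T n \<omega>) s"
    and "\<eta> \<equiv> \<lambda>j s \<omega>. hyp_dist \<i> (returning_particle j c (\<lambda>n. T n \<omega>) (\<lambda>n. b n \<omega>) s)"
    and "A \<equiv> (l + sqrt (l\<^sup>2 + 4 * c\<^sup>2)) / 2"
    and "B \<equiv> (l - sqrt (l\<^sup>2 + 4 * c\<^sup>2)) / 2"
  shows "integrable (uniform_measure M {\<omega> \<in> space M. k \<le> N t \<omega>}) (\<lambda>\<omega>. cosh (\<eta> k t \<omega>))
    \<and> (LINT \<omega> | uniform_measure M {\<omega> \<in> space M. k \<le> N t \<omega>}. cosh (\<eta> k t \<omega>))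
      = l ^ k * exp (- l * t)
          / (sqrt (l\<^sup>2 + 4 * c\<^sup>2) * measure M {\<omega> \<in> space M. k \<le> N t \<omega>})
        * (exp (A * t) / A ^ (k - 1) - exp (B * t) / B ^ (k - 1)
           + (\<Sum>i = 1..k - 1. (1 / B ^ i - 1 / A ^ i) * t ^ (k - i - 1) / fact (k - i - 1)))"
proof -
  interpret prob_space M by fact
  interpret P: poisson_events M l T
    using assms(2,4) by unfold_locales
  note c = \<open>c > 0\<close> and t = less_imp_le[OF \<open>t > 0\<close>]
  have N: "N = P.N" by (simp add: fun_eq_iff N_def P.N_def)
  define \<A> where "\<A> = {\<omega> \<in> space M. k \<le> N t \<omega>}"
  have [measurable]: "N t \<in> M \<rightarrow>\<^sub>M count_space UNIV" unfolding N using t by (rule P.N_measurable)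
  have \<A> [measurable]: "\<A> \<in> sets M" unfolding \<A>_def by measurable
  \<comment> \<open>Exactly \<open>k\<close> events already have positive probability, so the
    conditioning event does and may be divided by.\<close>
  have "0 < prob {\<omega> \<in> space M. N t \<omega> = k}"
    unfolding N P.prob_N[OF t] using \<open>l > 0\<close> \<open>t > 0\<close> by simp
  also have "\<dots> \<le> prob \<A>" by (rule finite_measure_mono) (auto simp: \<A>_def)
  finally have pos: "prob \<A> > 0" .
  define X where "X \<omega> = cosh (\<eta> k t \<omega>)" for \<omega>
  define R where "R j \<omega> = return_cosh c j (\<lambda>n. T n \<omega>) t" for j \<omega>
  have R: "integrable M (R j)" for j unfolding R_def by (rule P.return_cosh_integrable[OF c t])
  have X_eq: "X \<omega> = (if \<omega> \<in> \<A> then R k \<omega> else R 0 \<omega>)" if \<omega>: "\<omega> \<in> space M" for \<omega>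
  proof -
    interpret event_path "\<lambda>n. T n \<omega>" by (rule P.path[OF \<omega>])
    show ?thesis
      using P.le_N_iff[OF \<omega> t, of k] cosh_hyp_dist_returning_particle[OF c, of k t "\<lambda>n. b n \<omega>"]
        cosh_hyp_dist_returning_particle_before[OF c, of t k "\<lambda>n. b n \<omega>"] \<omega>
      by (auto simp: X_def R_def \<A>_def \<eta>_def N not_le)
  qed
  have [measurable]: "R j \<in> borel_measurable M" for j using R by auto
  have "(\<lambda>\<omega>. if \<omega> \<in> \<A> then R k \<omega> else R 0 \<omega>) \<in> borel_measurable M" by measurable
  then have X [measurable]: "X \<in> borel_measurable M"
    using X_eq by (simp cong: measurable_cong)
  have dens: "uniform_measure M \<A> = density M (\<lambda>\<omega>. ennreal (indicator \<A> \<omega> / prob \<A>))"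
  proof -
    have "1 / emeasure M \<A> = ennreal (1 / prob \<A>)"
      using divide_ennreal[of 1 "prob \<A>"] pos by (simp add: emeasure_eq_measure)
    then show ?thesis
      unfolding uniform_measure_def by (intro density_cong) (auto simp: indicator_def)
  qed
  \<comment> \<open>\<open>R k\<close> vanishes where fewer than \<open>k\<close> events have
    occurred, so it absorbs the indicator and the conditional mean reduces to
    \<open>mean_cosh\<close>.\<close>
  have ind: "(indicator \<A> \<omega> / prob \<A>) *\<^sub>R X \<omega> = R k \<omega> / prob \<A>" if "\<omega> \<in> space M" for \<omega>
    using X_eq[OF that] that by (auto simp: R_def \<A>_def N_def return_cosh_def indicator_def)
  have "integrable (uniform_measure M \<A>) X \<longleftrightarrow> integrable M (\<lambda>\<omega>. (indicator \<A> \<omega> / prob \<A>) *\<^sub>R X \<omega>)"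
    unfolding dens using pos by (intro integrable_density) auto
  also have "\<dots> \<longleftrightarrow> integrable M (\<lambda>\<omega>. R k \<omega> / prob \<A>)"
    using ind by (intro Bochner_Integration.integrable_cong) auto
  finally have int: "integrable (uniform_measure M \<A>) X" using R by simp
  have "(LINT \<omega> | uniform_measure M \<A>. X \<omega>) = (LINT \<omega> | M. (indicator \<A> \<omega> / prob \<A>) *\<^sub>R X \<omega>)"
    unfolding dens using pos by (intro integral_density) auto
  also have "\<dots> = (LINT \<omega> | M. R k \<omega> / prob \<A>)"
    using ind by (intro Bochner_Integration.integral_cong) auto
  also have "\<dots> = P.mean_cosh c k t / prob \<A>" by (simp add: P.mean_cosh_def R_def)
  also have "P.mean_cosh c k t = l ^ k * exp (- l * t) / sqrt (l\<^sup>2 + 4 * c\<^sup>2)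
      * (exp_rem (k - 1) A t - exp_rem (k - 1) B t)"
    unfolding A_def B_def using c \<open>k \<ge> 1\<close> t by (rule P.mean_cosh_eq)
  also have "exp_rem (k - 1) A t - exp_rem (k - 1) B t
      = exp (A * t) / A ^ (k - 1) - exp (B * t) / B ^ (k - 1)
           + (\<Sum>i = 1..k - 1. (1 / B ^ i - 1 / A ^ i) * t ^ (k - i - 1) / fact (k - i - 1))"
  proof -
    have "sqrt (l\<^sup>2 + 4 * c\<^sup>2) > l" using c by (intro real_less_rsqrt) simp
    then have "A \<noteq> 0" "B \<noteq> 0" using \<open>l > 0\<close> by (auto simp: A_def B_def)
    then show ?thesis
      by (simp add: exp_rem_eq_sum sum_subtractf left_diff_distrib diff_divide_distrib diff_right_commute)
  qed
  finally show ?thesis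
    using int unfolding X_def \<A>_def[symmetric] by simp
qed

end
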